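(* Let $E\subseteq\mathbb{R}^2$, and suppose that there exists an optimal Hausdorff oracle for $E$. Then $$\dim_H\left\{e\in\mathcal{S}^1 \;\middle|\; \dim_H(p_e E)<\frac{\dim_H E}{2}\right\}=0.$$
   Context: $\dim_H$ denotes Hausdorff dimension, $\mathcal{S}^1$ is the unit circle in $\mathbb{R}^2$, $p_ex$ is the orthogonal projection of $x\in\mathbb{R}^2$ onto the line through the origin in direction $e$ (identified with the real number $x\cdot e$), and $p_eE=\{p_ex : x\in E\}$. Kolmogorov complexity. Fix an oracle universal prefix Turing machine $U$ (for each oracle $A\subseteq\mathbb{N}$ the set of $\pi$ with $U^A(\pi)$ defined is prefix-free, and $U$ is optimal up to additive constants among such oracle machines). For $\sigma\in\{0,1\}^*$, $K^A(\sigma)=\min\{|\pi| : U^A(\pi)=\sigma\}$; via a standard binary encoding this extends to vectors of rationals. For $x\in\mathbb{R}^n$ and $r\in\mathbb{N}$, $K^A_r(x)=\min\{K^A(q) : q\in\mathbb{Q}^n,\ |q-x|<2^{-r}\}$, and $\dim^A(x)=\liminf_{r\to\infty}K^A_r(x)/r$. Several oracles in a superscript denote their Turing join. Hausdorff oracles. The point-to-set principle of J. Lutz and N. Lutz states that for all $E\subseteq\mathbb{R}^n$, $\dim_H E=\min_{A\subseteq\mathbb{N}}\sup_{x\in E}\dim^A(x)$. An oracle $A$ achieving this minimum is a Hausdorff oracle for $E$. A Hausdorff oracle $A$ for $E$ is an optimal Hausdorff oracle for $E$ if, for every $B\subseteq\mathbb{N}$ and every $\varepsilon>0$, there is some $x\in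 E$ such that $\dim^{A,B}(x)\geq\dim_H(E)-\varepsilon$ and, for all but finitely many $r\in\mathbb{N}$, $K_r^{A,B}(x)\geq K_r^A(x)-\varepsilon r$. *)

theory Defs
  imports "HOL-Analysis.Analysis" "HOL-Library.Sublist"
begin

section \<open>Oracle Turing machines\<close>

text \<open>
  Deterministic Turing machines with finitely many two-way infinite work tapes over the alphabet
  0, 1, blank (\<open>Some False\<close>, \<open>Some True\<close>, \<open>None\<close>), and one additional read-only, one-way infinite
  oracle tape on which the characteristic function of the oracle is written.

  A work tape \<open>(l, r)\<close> carries \<open>rev l @ r\<close>, padded with blanks on both sides, and its head
  scans the first cell of \<open>r\<close>.
\<close>

type_synonym symbol = "bool option"
type_synonym tape = "symbol list \<times> symbol list"

datatype move = MoveL | Stay | MoveR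

fun scan :: "tape \<Rightarrow> symbol" where
  "scan (l, []) = None"
| "scan (l, x # r) = x"

fun write_cell :: "symbol \<Rightarrow> tape \<Rightarrow> tape" where
  "write_cell x (l, r) = (l, x # tl r)"

fun move_tape :: "move \<Rightarrow> tape \<Rightarrow> tape" where
  "move_tape MoveL ([], r) = ([], None # r)"
| "move_tape MoveL (x # l, r) = (l, x # r)"
| "move_tape Stay t = t"
| "move_tape MoveR (l, r) = (scan (l, r) # l, tl r)"

text \<open>The oracle tape has cells 0, 1, 2, ...; a left move from cell 0 has no effect.\<close>

fun move_pos :: "move \<Rightarrow> nat \<Rightarrow> nat" where
  "move_pos MoveL n = n - 1"
| "move_pos Stay n = n"
| "move_pos MoveR n = Suc n"

text \<open>
  The transition function maps the state, the scanned oracle bit and the scanned work symbols to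
  the new state, the move on the oracle tape, and a symbol to write and a move for each work tape.
  The machine halts when the transition function is undefined.
\<close>

record oracle_machine =
  num_tapes :: nat
  trans :: "nat \<times> bool \<times> symbol list \<rightharpoonup> nat \<times> move \<times> (symbol \<times> move) list"

definition well_formed :: "oracle_machine \<Rightarrow> bool" where
  "well_formed M \<longleftrightarrow> num_tapes M > 0 \<and> finite (dom (trans M)) \<and>
     (\<forall>(q, m, as) \<in> ran (trans M). length as = num_tapes M)"

type_synonym config = "nat \<times> nat \<times> tape list"

fun step :: "oracle_machine \<Rightarrow> nat set \<Rightarrow> config \<Rightarrow> config option" where
  "step M A (q, h, ts) =
     (case trans M (q, h \<in> A, map scan ts) of
        None \<Rightarrow> None
      | Some (q', m, as) \<Rightarrow>
          Some (q', move_pos m h, map2 (\<lambda>(x, d) t. move_tape d (write_cell x t)) as ts))"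

definition init_config :: "oracle_machine \<Rightarrow> bool list \<Rightarrow> config" where
  "init_config M \<pi> = (0, 0, ([], map Some \<pi>) # replicate (num_tapes M - 1) ([], []))"

text \<open>The output is the blank-free string on the first tape that starts at the head.\<close>

fun tape_output :: "config \<Rightarrow> bool list" where
  "tape_output (q, h, ts) = map the (takeWhile (\<lambda>x. x \<noteq> None) (snd (hd ts)))"

definition computes :: "oracle_machine \<Rightarrow> nat set \<Rightarrow> bool list \<Rightarrow> bool list \<Rightarrow> bool" where
  "computes M A \<pi> \<sigma> \<longleftrightarrow>
     (\<exists>c. (\<lambda>c c'. step M A c = Some c')\<^sup>*\<^sup>* (init_config M \<pi>) c \<and> step M A c = None \<and> tape_output c = \<sigma>)"

definition prefix_machine :: "oracle_machine \<Rightarrow> bool" where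
  "prefix_machine M \<longleftrightarrow> well_formed M \<and>
     (\<forall>A \<pi> \<pi>' \<sigma> \<sigma>'. computes M A \<pi> \<sigma> \<and> computes M A \<pi>' \<sigma>' \<and> prefix \<pi> \<pi>' \<longrightarrow> \<pi> = \<pi>')"


section \<open>Kolmogorov complexity\<close>

definition KC :: "oracle_machine \<Rightarrow> nat set \<Rightarrow> bool list \<Rightarrow> enat" where
  "KC M A \<sigma> = (INF \<pi> \<in> {\<pi>. computes M A \<pi> \<sigma>}. enat (length \<pi>))"

definition universal_prefix_machine :: "oracle_machine \<Rightarrow> bool" where
  "universal_prefix_machine U \<longleftrightarrow> prefix_machine U \<and>
     (\<forall>M. prefix_machine M \<longrightarrow> (\<exists>c::nat. \<forall>A \<sigma>. KC U A \<sigma> \<le> KC M A \<sigma> + enat c))"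

text \<open>
  Encoding of rational vectors: numbers in binary (least significant bit first), made
  self-delimiting; a rational is its sign followed by numerator and denominator in lowest terms;
  a vector is the concatenation of its coordinates in increasing order of the index.
\<close>

fun binary :: "nat \<Rightarrow> bool list" where
  "binary n = (if n = 0 then [] else odd n # binary (n div 2))"

declare binary.simps [simp del]

fun delimited :: "bool list \<Rightarrow> bool list" where
  "delimited [] = [False]"
| "delimited (b # bs) = True # b # delimited bs"

definition encode_rat :: "rat \<Rightarrow> bool list" where
  "encode_rat q = (case quotient_of q of (a, b) \<Rightarrow>
     (a < 0) # delimited (binary (nat \<bar>a\<bar>)) @ delimited (binary (nat b)))"

definition encode_vec :: "rat ^ 'n::{finite, linorder} \<Rightarrow> bool list" where
  "encode_vec q = concat (map (\<lambda>i. encode_rat (q $ i)) (sorted_list_of_set UNIV))"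

definition KC_prec ::
    "oracle_machine \<Rightarrow> nat set \<Rightarrow> nat \<Rightarrow> real ^ 'n::{finite, linorder} \<Rightarrow> enat" where
  "KC_prec U A r x =
     (INF q \<in> {q :: (rat, 'n) vec. norm ((\<chi> i. of_rat (q $ i)) - x) < 1 / 2 ^ r}. KC U A (encode_vec q))"

definition point_dim ::
    "oracle_machine \<Rightarrow> nat set \<Rightarrow> real ^ 'n::{finite, linorder} \<Rightarrow> ereal" where
  "point_dim U A x = liminf (\<lambda>r. ereal_of_enat (KC_prec U A r x) / ereal (real r))"

definition oracle_join :: "nat set \<Rightarrow> nat set \<Rightarrow> nat set" (infixl "\<squnion>\<^sub>T" 65) where
  "A \<squnion>\<^sub>T B = {2 * n | n. n \<in> A} \<union> {2 * n + 1 | n. n \<in> B}"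


section \<open>Hausdorff dimension\<close>

text \<open>
  \<open>diameter\<close> is only meaningful on bounded sets, and \<open>0 powr 0 = 0\<close>; hence the boundedness
  condition on the covers and the restriction to positive exponents \<open>s\<close> in \<open>hausdorff_dim\<close>,
  which does not affect the infimum. In particular the empty set has dimension 0.
\<close>

definition hausdorff_premeasure :: "real \<Rightarrow> real \<Rightarrow> 'a::metric_space set \<Rightarrow> ennreal" where
  "hausdorff_premeasure s \<delta> E =
     (INF C \<in> {C :: nat \<Rightarrow> 'a set. E \<subseteq> (\<Union>i. C i) \<and> (\<forall>i. bounded (C i) \<and> diameter (C i) \<le> \<delta>)}.
        \<Sum>i. ennreal (diameter (C i) powr s))"

definition hausdorff_measure :: "real \<Rightarrow> 'a::metric_space set \<Rightarrow> ennreal" where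
  "hausdorff_measure s E = (SUP \<delta> \<in> {0<..}. hausdorff_premeasure s \<delta> E)"

definition hausdorff_dim :: "'a::metric_space set \<Rightarrow> ereal" where
  "hausdorff_dim E = Inf {ereal s | s. 0 < s \<and> hausdorff_measure s E = 0}"


section \<open>Hausdorff oracles\<close>

definition hausdorff_oracle ::
    "oracle_machine \<Rightarrow> nat set \<Rightarrow> (real ^ 'n::{finite, linorder}) set \<Rightarrow> bool" where
  "hausdorff_oracle U A E \<longleftrightarrow> (SUP x \<in> E. point_dim U A x) = hausdorff_dim E"

definition optimal_hausdorff_oracle ::
    "oracle_machine \<Rightarrow> nat set \<Rightarrow> (real ^ 'n::{finite, linorder}) set \<Rightarrow> bool" where
  "optimal_hausdorff_oracle U A E \<longleftrightarrow> hausdorff_oracle U A E \<and>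
     (\<forall>B. \<forall>\<epsilon>>0. \<exists>x\<in>E.
        point_dim U (A \<squnion>\<^sub>T B) x \<ge> hausdorff_dim E - ereal \<epsilon> \<and>
        (\<forall>\<^sub>F r in sequentially.
           ereal_of_enat (KC_prec U (A \<squnion>\<^sub>T B) r x)
             \<ge> ereal_of_enat (KC_prec U A r x) - ereal (\<epsilon> * real r)))"

end

theory Submission
  imports Defs "HOL-Real_Asymp.Real_Asymp"
begin

text \<open>
  Let \<open>A\<close> be an optimal Hausdorff oracle for \<open>E\<close>, \<open>2 s < d < dim\<^sub>H E\<close>, and let \<open>e\<close> be a direction with
  \<open>dim\<^sub>H (p\<^sub>e E) < s\<close>. At infinitely many scales \<open>r\<close>, each point of \<open>E\<close> lies in one of \<open>2\<^bsup>s r\<^esup>\<close> strips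
  of width about \<open>2\<^bsup>-r\<^esup>\<close> orthogonal to \<open>e\<close>, where the strips depend only on \<open>r\<close> and \<open>e\<close>. Since
  oracles are arbitrary, some \<open>B\<close> tabulates the grid points that lie in these strips and are close to
  points of complexity at most \<open>n\<close> relative to \<open>A\<close>. For the point \<open>x\<close> which optimality yields for
  \<open>B\<close>, a table lookup describes \<open>x\<close> relative to \<open>A, B\<close>; as this cannot be much shorter than
  \<open>n = K\<^sup>A\<^sub>r(x)\<close>, the strips contain at least \<open>2\<^bsup>n - 2 \<epsilon> r\<^esup>\<close> of the at most \<open>O(2\<^sup>n)\<close> points in question.

  Two directions at angle at least \<open>2\<^bsup>-\<kappa> r\<^esup>\<close> share only \<open>O(2\<^bsup>(2 s + 2 \<kappa>) r\<^esup>)\<close> points, far fewer than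
  \<open>2\<^bsup>d r\<^esup>\<close>. By inclusion-exclusion, at each scale these directions are covered by \<open>2\<^bsup>O(\<epsilon> r)\<^esup>\<close> arcs of
  length \<open>2\<^bsup>-\<kappa> r\<^esup>\<close>. The exceptional set is contained in the limit superior of such covers, and \<open>\<epsilon>\<close> is
  arbitrary while \<open>\<kappa>\<close> is fixed.
\<close>

section \<open>A table lookup machine\<close>

text \<open>
  A single-tape machine that uses the odd cells of the oracle tape as a list of entries
  \<open>delimited p @ delimited s\<close> and outputs \<open>s\<close> for the first entry with \<open>p\<close> equal to the input.
  An even state below 16 only skips an even oracle cell and is followed by its odd successor, which
  reads a bit: 1 and 3 compare \<open>p\<close> with the input, 5 and 7 skip the rest of \<open>p\<close>, 9 and 11 skip
  \<open>s\<close>, 13 and 15 copy \<open>s\<close> behind the input. States 16 and 18 move back to the left end of the input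
  and of the output, 17 checks that the input is exhausted, 19 loops and 20 halts.
\<close>

definition lookup_rule :: "nat \<Rightarrow> bool \<Rightarrow> symbol \<Rightarrow> (nat \<times> move \<times> symbol \<times> move) option" where
  "lookup_rule q b a =
    (if q < 16 \<and> even q then Some (Suc q, MoveR, a, Stay)
     else if q = 1 then Some (if b then 2 else 17, MoveR, a, Stay)
     else if q = 3 then
       (if a = None then Some (19, Stay, a, Stay)
        else if a = Some b then Some (0, MoveR, a, MoveR)
        else Some (16, MoveR, a, Stay))
     else if q = 5 then Some (if b then 6 else 8, MoveR, a, Stay)
     else if q = 7 then Some (4, MoveR, a, Stay)
     else if q = 9 then Some (if b then 10 else 0, MoveR, a, Stay)
     else if q = 11 then Some (8, MoveR, a, Stay)
     else if q = 13 then (if b then Some (14, MoveR, a, Stay) else Some (18, Stay, a, MoveL))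
     else if q = 15 then Some (12, MoveR, Some b, MoveR)
     else if q = 16 then (if a = None then Some (4, Stay, a, MoveR) else Some (16, Stay, a, MoveL))
     else if q = 17 then (if a = None then Some (12, Stay, a, MoveR) else Some (19, Stay, a, Stay))
     else if q = 18 then (if a = None then Some (20, Stay, a, MoveR) else Some (18, Stay, a, MoveL))
     else if q = 19 then Some (19, Stay, a, Stay)
     else None)"

definition lookup_machine :: oracle_machine where
  "lookup_machine = \<lparr>num_tapes = 1,
     trans = (\<lambda>(q, b, as). if length as = 1
        then map_option (\<lambda>(q', m, x, d). (q', m, [(x, d)])) (lookup_rule q b (hd as)) else None)\<rparr>"

lemma step_lookup:
  "step lookup_machine X (q, h, [t]) =
     (case lookup_rule q (h \<in> X) (scan t) of None \<Rightarrow> None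
      | Some (q', m, x, d) \<Rightarrow> Some (q', move_pos m h, [move_tape d (write_cell x t)]))"
  by (auto simp: lookup_machine_def split: option.splits)

declare step.simps [simp del]

lemma init_config_lookup: "init_config lookup_machine \<pi> = (0, 0, [([], map Some \<pi>)])"
  by (simp add: init_config_def lookup_machine_def)

lemma well_formed_lookup: "well_formed lookup_machine"
proof -
  have "dom (trans lookup_machine) \<subseteq> {..<20} \<times> UNIV \<times> (\<lambda>a. [a]) ` UNIV"
  proof (clarify, goal_cases)
    case (1 q b as q' m xs)
    then obtain a where a: "as = [a]" "lookup_rule q b a \<noteq> None"
      by (cases as) (auto simp: lookup_machine_def split: if_splits)
    have "q < 20"
    proof (rule ccontr)
      assume "\<not> q < 20"
      then have "lookup_rule q b a = None" by (simp add: lookup_rule_def)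
      with a show False by simp
    qed
    with a show ?case by auto
  qed
  moreover have "finite ({..<20::nat} \<times> (UNIV :: bool set) \<times> (\<lambda>a::symbol. [a]) ` UNIV)"
    by (intro finite_cartesian_product finite_imageI) auto
  ultimately have "finite (dom (trans lookup_machine))"
    by (rule finite_subset)
  then show ?thesis
    by (auto simp: well_formed_def lookup_machine_def ran_def split: if_splits)
qed

abbreviation lookup_reach :: "nat set \<Rightarrow> config \<Rightarrow> config \<Rightarrow> bool" where
  "lookup_reach X \<equiv> (\<lambda>c c'. step lookup_machine X c = Some c')\<^sup>*\<^sup>*"

lemma reach_step: "step lookup_machine X c = Some c' \<Longrightarrow> lookup_reach X c' c'' \<Longrightarrow> lookup_reach X c c''"
  by (rule converse_rtranclp_into_rtranclp)

section \<open>Determinism and prefix-freeness of the lookup machine\<close>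

lemma loop_reach:
  "lookup_reach X c c' \<Longrightarrow> \<exists>h t. c = (19, h, [t]) \<Longrightarrow> \<exists>h t. c' = (19, h, [t])"
proof (induction rule: rtranclp_induct)
  case base
  then show ?case .
next
  case (step y z)
  then obtain h t where "y = (19, h, [t])" by auto
  with step.hyps(2) show ?case by (auto simp: step_lookup lookup_rule_def)
qed

lemma loop_not_halting:
  assumes "lookup_reach X (19, h, [t]) c" shows "step lookup_machine X c \<noteq> None"
proof -
  obtain h' t' where "c = (19, h', [t'])" using loop_reach[OF assms] by blast
  then show ?thesis by (simp add: step_lookup lookup_rule_def)
qed

lemma halting_unique:
  assumes "(\<lambda>c c'. step M A c = Some c')\<^sup>*\<^sup>* c d" "step M A d = None"
    and "(\<lambda>c c'. step M A c = Some c')\<^sup>*\<^sup>* c d'" "step M A d' = None"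
  shows "d = d'"
  using assms
proof (induction rule: converse_rtranclp_induct)
  case base
  from base(2) show ?case
    by (cases rule: converse_rtranclpE) (use base in auto)
next
  case (step y z)
  from step.prems(2) show ?case
    by (cases rule: converse_rtranclpE) (use step in auto)
qed

lemma computes_functional: "computes M A \<pi> \<sigma> \<Longrightarrow> computes M A \<pi> \<sigma>' \<Longrightarrow> \<sigma> = \<sigma>'"
  unfolding computes_def using halting_unique by metis

text \<open>
  Invariant of the parallel runs on \<open>\<pi>\<close> and \<open>\<pi> @ \<tau>\<close>, valid for any oracle until the first run reacts
  to the blank after \<open>\<pi>\<close>. At that moment at least one of the two runs enters the looping
  state 19, so the domain is prefix-free whatever the oracle contains.
\<close>

definition in_step :: "bool list \<Rightarrow> config \<Rightarrow> config \<Rightarrow> bool" where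
  "in_step \<tau> c c' \<longleftrightarrow> (\<exists>q h l u k.
     c = (q, h, [(l, u @ replicate k None)]) \<and> c' = (q, h, [(l, u @ map Some \<tau>)]) \<and>
     ((\<exists>w l0 v. l = map Some w @ l0 \<and> (l0 = [] \<or> l0 = [None]) \<and> u = map Some v \<and>
         (q < 12 \<or> q = 17 \<or> q = 16 \<and> v \<noteq> [])) \<or>
      (\<exists>v. l = [] \<and> u = None # map Some v \<and> q = 16)))"

lemma in_stepI1:
  assumes "l0 = [] \<or> l0 = [None]" "q < 12 \<or> q = 17 \<or> q = 16 \<and> v \<noteq> []"
  shows "in_step \<tau> (q, h, [(map Some w @ l0, map Some v @ replicate k None)])
                   (q, h, [(map Some w @ l0, map Some v @ map Some \<tau>)])"
  unfolding in_step_def using assms by blast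

lemma in_stepI2:
  "in_step \<tau> (16, h, [([], None # map Some v @ replicate k None)])
                   (16, h, [([], None # map Some v @ map Some \<tau>)])"
  unfolding in_step_def by (metis append_Cons)

text \<open>The two tapes differ only behind the common part \<open>u\<close>, so the runs react
  alike until the head has crossed \<open>u\<close>. At that point only states 3 and 17 depend on
  the scanned symbol: in state 3 the blank sends the first run to state 19, in state 17 the bit of
  \<open>\<tau>\<close> sends the second run there.\<close>

lemma in_step_progress:
  assumes "in_step \<tau> c c'" "\<tau> \<noteq> []"
  obtains d d' where "step lookup_machine X c = Some d" "step lookup_machine X c' = Some d'"
    "in_step \<tau> d d' \<or> (\<exists>h t. d = (19, h, [t])) \<or> (\<exists>h t. d' = (19, h, [t]))"
proof -
  have "\<exists>d d'. step lookup_machine X c = Some d \<and> step lookup_machine X c' = Some d' \<and>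
    (in_step \<tau> d d' \<or> (\<exists>h t. d = (19, h, [t])) \<or> (\<exists>h t. d' = (19, h, [t])))"
  proof -
    obtain b \<tau>' where \<tau>: "\<tau> = b # \<tau>'" using assms(2) by (cases \<tau>) auto
    obtain q h l u k where c: "c = (q, h, [(l, u @ replicate k None)])" "c' = (q, h, [(l, u @ map Some \<tau>)])"
      and alt: "(\<exists>w l0 v. l = map Some w @ l0 \<and> (l0 = [] \<or> l0 = [None]) \<and> u = map Some v \<and>
         (q < 12 \<or> q = 17 \<or> q = 16 \<and> v \<noteq> [])) \<or>
      (\<exists>v. l = [] \<and> u = None # map Some v \<and> q = 16)"
      using assms(1) unfolding in_step_def by blast
    from alt show ?thesis
    proof (rule disjE)
      assume "\<exists>v. l = [] \<and> u = None # map Some v \<and> q = 16"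
      then obtain v where *: "l = []" "u = None # map Some v" "q = 16" by blast
      have "in_step \<tau> (4, h, [([None], map Some v @ replicate k None)]) (4, h, [([None], map Some v @ map Some \<tau>)])"
        using in_stepI1[of "[None]" 4 v \<tau> h "[]" k] by simp
      with * show ?thesis by (simp add: c step_lookup lookup_rule_def)
    next
      assume "\<exists>w l0 v. l = map Some w @ l0 \<and> (l0 = [] \<or> l0 = [None]) \<and> u = map Some v \<and>
         (q < 12 \<or> q = 17 \<or> q = 16 \<and> v \<noteq> [])"
      then obtain w l0 v where *: "l = map Some w @ l0" "l0 = [] \<or> l0 = [None]" "u = map Some v"
        and q: "q < 12 \<or> q = 17 \<or> q = 16 \<and> v \<noteq> []" by blast
      \<comment> \<open>A step writes the scanned symbol back. At the right end of an unpadded tape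
        this turns an empty tail into one explicit blank, which is why \<open>in_step\<close> allows
        any number \<open>k\<close> of blanks.\<close>
      have stay: "in_step \<tau> (q', h', [(l, None # replicate (k - 1) None)]) (q', h', [(l, map Some \<tau>)])"
        if "v = []" "q' < 12 \<or> q' = 17" for q' h'
        using in_stepI1[of l0 q' "[]" \<tau> h' w "Suc (k - 1)"] that * by simp
      have stay2: "in_step \<tau> (q', h', [(l, map Some v @ replicate k None)]) (q', h', [(l, map Some v @ map Some \<tau>)])"
        if "q' < 12 \<or> q' = 17 \<or> q' = 16 \<and> v \<noteq> []" for q' h'
        using in_stepI1[of l0 q' v \<tau> h' w k] that * by simp
      have scan0: "scan (l, replicate k None) = None" by (cases k) auto
      have tl0: "tl (replicate k (None::symbol)) = replicate (k - 1) None" by (cases k) auto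
      show ?thesis
      proof (cases v)
        case Nil
        have "q \<in> {0,1,2,3,4,5,6,7,8,9,10,11,17}"
          using q Nil by (simp, presburger)
        then show ?thesis
          apply (elim insertE emptyE)
          apply (simp_all add: c *(3) Nil step_lookup lookup_rule_def scan0 tl0 stay[OF Nil, unfolded \<tau>, simplified] \<tau>)
          done
      next
        case (Cons a v')
        have fwd: "in_step \<tau> (0, h', [(Some a # l, map Some v' @ replicate k None)]) (0, h', [(Some a # l, map Some v' @ map Some \<tau>)])" for h'
          using in_stepI1[of l0 0 v' \<tau> h' "a # w" k] * by simp
        have bwd: "in_step \<tau> (16, h, [move_tape MoveL (l, map Some v @ replicate k None)])
             (16, h, [move_tape MoveL (l, map Some v @ map Some \<tau>)])"
        proof (cases w)
          case Nil
          then show ?thesis using in_stepI2[of \<tau> h v k] * by auto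
        next
          case (Cons x w')
          then show ?thesis using in_stepI1[of l0 16 "x # v" \<tau> h w' k] * by auto
        qed
        have "q < 12 \<or> q = 16 \<or> q = 17" using q by auto
        then have "q \<in> {0,1,2,3,4,5,6,7,8,9,10,11,16,17}" by (simp, presburger)
        then show ?thesis
          apply (elim insertE emptyE)
          apply (simp_all add: c *(3) Cons step_lookup lookup_rule_def stay2[unfolded Cons, simplified] fwd bwd[unfolded Cons, simplified])
          apply (intro conjI impI; insert fwd[of "Suc h"] stay2[of 16 "Suc h", unfolded Cons, simplified]; simp)
          done
      qed
    qed
  qed
  then show thesis using that by blast
qed

text \<open>While the relation holds, both configurations have a successor; it can only end with one
  of the runs in state 19. The run from \<open>c\<close> halts, so it is the run from
  \<open>c'\<close> that loops.\<close>

lemma in_step_not_halting: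
  assumes "lookup_reach X c e" "step lookup_machine X e = None" "in_step \<tau> c c'" "\<tau> \<noteq> []"
    and "lookup_reach X c' e'"
  shows "step lookup_machine X e' \<noteq> None"
  using assms(1,3,5)
proof (induction arbitrary: c' rule: converse_rtranclp_induct)
  case base
  then show ?case using in_step_progress[OF base(1) assms(4), of X] assms(2) by auto
next
  case (step y z)
  obtain d d' where d: "step lookup_machine X y = Some d" "step lookup_machine X c' = Some d'"
    "in_step \<tau> d d' \<or> (\<exists>h t. d = (19, h, [t])) \<or> (\<exists>h t. d' = (19, h, [t]))"
    using in_step_progress[OF step.prems(1) assms(4), of X] by blast
  have [simp]: "d = z" using d step.hyps by simp
  from step.prems(2) show ?case
  proof (cases rule: converse_rtranclpE)
    case base
    then show ?thesis using d by auto
  next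
    case (step z')
    then have z': "z' = d'" using d by simp
    from d(3) show ?thesis
    proof (elim disjE exE)
      assume "in_step \<tau> d d'"
      then show ?thesis using \<open>\<And>c'. _ \<Longrightarrow> _ \<Longrightarrow> _\<close> step z' by auto
    next
      fix h t assume "d = (19, h, [t])"
      then show ?thesis using loop_not_halting[of X h t e] \<open>lookup_reach X z e\<close> assms(2) by simp
    next
      fix h t assume "d' = (19, h, [t])"
      then show ?thesis using loop_not_halting[of X h t e'] step z' by simp
    qed
  qed
qed

lemma prefix_machine_lookup: "prefix_machine lookup_machine"
  unfolding prefix_machine_def
proof (intro conjI allI impI well_formed_lookup)
  fix X \<pi> \<pi>' \<sigma> \<sigma>'
  assume *: "computes lookup_machine X \<pi> \<sigma> \<and> computes lookup_machine X \<pi>' \<sigma>' \<and> prefix \<pi> \<pi>'"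
  then obtain \<tau> where \<tau>: "\<pi>' = \<pi> @ \<tau>" by (auto simp: prefix_def)
  show "\<pi> = \<pi>'"
  proof (rule ccontr)
    assume "\<pi> \<noteq> \<pi>'"
    then have "\<tau> \<noteq> []" using \<tau> by auto
    have "in_step \<tau> (init_config lookup_machine \<pi>) (init_config lookup_machine \<pi>')"
      using in_stepI1[of "[]" 0 \<pi> \<tau> 0 "[]" 0] by (simp add: init_config_lookup \<tau>)
    then show False
      using * in_step_not_halting[OF _ _ _ \<open>\<tau> \<noteq> []\<close>] unfolding computes_def by metis
  qed
qed

section \<open>Correctness of the table lookup on the odd oracle cells\<close>

definition reads :: "nat set \<Rightarrow> nat \<Rightarrow> bool list \<Rightarrow> bool" where
  "reads X j bs \<longleftrightarrow> (\<forall>k<length bs. (2 * (j + k) + 1 \<in> X) = bs ! k)"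

lemma reads_Cons: "reads X j (b # bs) \<longleftrightarrow> (Suc (2 * j) \<in> X) = b \<and> reads X (Suc j) bs"
proof -
  have "reads X j (b # bs) \<longleftrightarrow> (\<forall>k<Suc (length bs). (2 * (j + k) + 1 \<in> X) = (b # bs) ! k)"
    by (simp add: reads_def)
  then show ?thesis unfolding All_less_Suc2 by (simp add: reads_def)
qed

lemma reads_append: "reads X j (as @ bs) \<longleftrightarrow> reads X j as \<and> reads X (j + length as) bs"
  by (induction as arbitrary: j) (auto simp: reads_Cons, simp add: reads_def)

text \<open>Writing back makes the scanned cell explicit when the list \<open>r\<close> was empty,
  hence the form \<open>scan (l, r) # tl r\<close>.\<close>

lemma pending_step:
  assumes "q < 16" "even q"
  shows "step lookup_machine X (q, h, [(l, r)]) = Some (Suc q, Suc h, [(l, scan (l, r) # tl r)])"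
  using assms by (simp add: step_lookup lookup_rule_def)

text \<open>The bits of the table sit in the odd cells \<open>Suc (2 * j)\<close>, and each bit
  costs two steps, one of them for an even cell. The right part is taken nonempty,
  \<open>a # r\<close>, so that writing back does not change its representation.\<close>

lemma reach_skip2:
  assumes "reads X j (delimited p)"
  shows "lookup_reach X (9, Suc (2 * j), [(l, a # r)])
     (1, Suc (2 * (j + length (delimited p))), [(l, a # r)])"
  using assms
proof (induction p arbitrary: j)
  case Nil
  then show ?case
    apply (simp add: reads_Cons)
    apply (rule reach_step, simp add: step_lookup lookup_rule_def)
    apply (rule reach_step, simp add: step_lookup lookup_rule_def)
    apply simp
    done
next
  case (Cons b p)
  have IH: "lookup_reach X (9, Suc (2 * (j + 2)), [(l, a # r)])
     (1, Suc (2 * (j + 2 + length (delimited p))), [(l, a # r)])"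
    using Cons.IH[of "j + 2"] Cons.prems by (simp add: reads_Cons)
  show ?case
    apply (rule reach_step, use Cons.prems in \<open>simp add: reads_Cons step_lookup lookup_rule_def\<close>)
    apply (rule reach_step, simp add: step_lookup lookup_rule_def)
    apply (rule reach_step, simp add: step_lookup lookup_rule_def)
    apply (rule reach_step, simp add: step_lookup lookup_rule_def)
    using IH apply simp
    done
qed

lemma reach_skip1:
  assumes "reads X j (delimited p)"
  shows "lookup_reach X (5, Suc (2 * j), [(l, a # r)])
     (9, Suc (2 * (j + length (delimited p))), [(l, a # r)])"
  using assms
proof (induction p arbitrary: j)
  case Nil
  then show ?case
    apply (simp add: reads_Cons)
    apply (rule reach_step, simp add: step_lookup lookup_rule_def)
    apply (rule reach_step, simp add: step_lookup lookup_rule_def)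
    apply simp
    done
next
  case (Cons b p)
  have IH: "lookup_reach X (5, Suc (2 * (j + 2)), [(l, a # r)])
     (9, Suc (2 * (j + 2 + length (delimited p))), [(l, a # r)])"
    using Cons.IH[of "j + 2"] Cons.prems by (simp add: reads_Cons)
  show ?case
    apply (rule reach_step, use Cons.prems in \<open>simp add: reads_Cons step_lookup lookup_rule_def\<close>)
    apply (rule reach_step, simp add: step_lookup lookup_rule_def)
    apply (rule reach_step, simp add: step_lookup lookup_rule_def)
    apply (rule reach_step, simp add: step_lookup lookup_rule_def)
    using IH apply simp
    done
qed

text \<open>The blank to the left of the input is implicit before the first rewind
  (\<open>l0 = []\<close>) and explicit afterwards (\<open>l0 = [None]\<close>). Both cases end in
  the same configuration, so rewinds can be repeated.\<close>

lemma reach_rewind: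
  assumes "l0 = [] \<or> l0 = [None]"
  shows "lookup_reach X (16, h, [(map Some w @ l0, Some a # r)]) (4, h, [([None], map Some (rev w) @ Some a # r)])"
proof (induction w arbitrary: a r)
  case Nil
  show ?case
    apply (rule reach_step, simp add: step_lookup lookup_rule_def)
    apply (rule reach_step[of _ _ "(4, h, [([None], Some a # r)])"])
    using assms by (auto simp add: step_lookup lookup_rule_def)
next
  case (Cons x w)
  show ?case
    apply (rule reach_step, simp add: step_lookup lookup_rule_def)
    using Cons.IH[of x "Some a # r"] by simp
qed

text \<open>Incomparability of \<open>p\<close> and \<open>v\<close> guarantees a differing bit
  before either string ends, which keeps the comparison out of states 17 and 19. The part of the
  input that is already matched is \<open>w\<close>, in reverse.\<close>

lemma reach_mismatch:
  assumes "reads X j (delimited p)" "\<not> prefix p v" "\<not> prefix v p" "l0 = [] \<or> l0 = [None]"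
  shows "lookup_reach X (1, Suc (2 * j), [(map Some w @ l0, map Some v @ z)])
     (9, Suc (2 * (j + length (delimited p))), [([None], map Some (rev w @ v) @ z)])"
  using assms(1-3)
proof (induction p arbitrary: j v w)
  case Nil
  then show ?case by simp
next
  case (Cons b p)
  then obtain a v' where v: "v = a # v'" by (cases v) auto
  have r: "Suc (2 * j) \<in> X" "(Suc (Suc (Suc (2 * j))) \<in> X) = b" "reads X (j + 2) (delimited p)"
    using Cons.prems(1) by (auto simp add: reads_Cons)
  show ?case
  proof (cases "a = b")
    case True
    then have np: "\<not> prefix p v'" "\<not> prefix v' p" using Cons.prems v by auto
    then obtain a' v'' where v': "v' = a' # v''" by (cases v') auto
    show ?thesis
      apply (rule reach_step, use r v in \<open>simp add: step_lookup lookup_rule_def\<close>)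
      apply (rule reach_step, simp add: step_lookup lookup_rule_def)
      apply (rule reach_step, use r True in \<open>simp add: step_lookup lookup_rule_def\<close>)
      apply (rule reach_step, use v' in \<open>simp add: step_lookup lookup_rule_def\<close>)
      using Cons.IH[OF r(3) np, of "b # w"] v v' True apply simp
      done
  next
    case False
    \<comment> \<open>\<open>reach_skip1\<close> expects a nonempty right part; after the rewind it
      contains the mismatched bit.\<close>
    obtain a0 r0 where a0: "map Some (rev w) @ Some (\<not> b) # (map Some v' @ z) = a0 # r0"
      by (cases "map Some (rev w) @ Some (\<not> b) # (map Some v' @ z)") auto
    then have a0': "map Some (rev w @ v) @ z = a0 # r0" using v False by simp
    show ?thesis
      apply (rule reach_step, use r v in \<open>simp add: step_lookup lookup_rule_def\<close>)
      apply (rule reach_step, simp add: step_lookup lookup_rule_def)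
      apply (rule reach_step, use r False in \<open>simp add: step_lookup lookup_rule_def\<close>)
      apply (rule rtranclp_trans[OF reach_rewind[OF assms(4)]])
      apply (simp only: a0)
      apply (rule reach_step, simp add: step_lookup lookup_rule_def)
      using reach_skip1[OF r(3), of "[None]" a0 r0] v a0' apply simp
      done
  qed
qed

abbreviation blank_cells :: "symbol list \<Rightarrow> bool" where
  "blank_cells z \<equiv> \<forall>x\<in>set z. x = None"

lemma scan_blank: "blank_cells z \<Longrightarrow> scan (l, z) = None"
  by (cases z) auto

lemma blank_tl: "blank_cells z \<Longrightarrow> blank_cells (tl z)"
  by (cases z) auto

text \<open>Scanning may append one explicit blank at the end of the tape. Tapes are therefore
  described only up to some blank tail \<open>z'\<close>.\<close>

lemma touch_blank:
  assumes "blank_cells z"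
  obtains z' where "blank_cells z'" "scan (l, map Some v @ z) # tl (map Some v @ z) = map Some v @ z'"
proof (cases v)
  case Nil
  with that[of "None # tl z"] assms show thesis by (auto simp: scan_blank blank_tl)
qed (use that assms in auto)

lemma reach_match:
  assumes "reads X j (delimited p)" "blank_cells z"
  shows "\<exists>z'. blank_cells z' \<and> lookup_reach X (1, Suc (2 * j), [(l, map Some p @ z)])
     (17, 2 * (j + length (delimited p)), [(map Some (rev p) @ l, z')])"
  using assms
proof (induction p arbitrary: j l z)
  case Nil
  have "step lookup_machine X (1, Suc (2 * j), [(l, z)]) = Some (17, Suc (Suc (2 * j)), [(l, None # tl z)])"
    using Nil by (simp add: reads_Cons step_lookup lookup_rule_def scan_blank)
  then show ?case using Nil
    by (intro exI[of _ "None # tl z"]) (auto simp: blank_tl)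
next
  case (Cons b p)
  have r: "Suc (2 * j) \<in> X" "(Suc (Suc (Suc (2 * j))) \<in> X) = b" "reads X (j + 2) (delimited p)"
    using Cons.prems(1) by (auto simp add: reads_Cons)
  obtain z' where z': "blank_cells z'" "scan (Some b # l, map Some p @ z) # tl (map Some p @ z) = map Some p @ z'"
    using touch_blank[OF Cons.prems(2)] .
  obtain z'' where z'': "blank_cells z''" "lookup_reach X (1, Suc (2 * (j + 2)), [(Some b # l, map Some p @ z')])
     (17, 2 * (j + 2 + length (delimited p)), [(map Some (rev p) @ Some b # l, z'')])"
    using Cons.IH[OF r(3) z'(1)] by blast
  have "lookup_reach X (1, Suc (2 * j), [(l, map Some (b # p) @ z)])
     (17, 2 * (j + length (delimited (b # p))), [(map Some (rev (b # p)) @ l, z'')])"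
    apply (rule reach_step, use r in \<open>simp add: step_lookup lookup_rule_def\<close>)
    apply (rule reach_step, simp add: step_lookup lookup_rule_def)
    apply (rule reach_step, use r in \<open>simp add: step_lookup lookup_rule_def\<close>)
    apply (rule reach_step, rule pending_step, simp, simp)
    using z''(2) apply (simp add: z'(2))
    done
  then show ?case using z''(1) by blast
qed

text \<open>The last left move stays unevaluated because the cell that it uncovers depends on
  whether \<open>s\<close> is empty.\<close>

lemma reach_copy:
  assumes "reads X j (delimited s)" "blank_cells z"
  shows "\<exists>h z'. blank_cells z' \<and> lookup_reach X (13, Suc (2 * j), [(l, z)])
     (18, h, [move_tape MoveL (map Some (rev s) @ l, z')])"
  using assms
proof (induction s arbitrary: j l z)
  case Nil
  have "step lookup_machine X (13, Suc (2 * j), [(l, z)]) = Some (18, Suc (2 * j), [move_tape MoveL (l, None # tl z)])"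
    using Nil by (simp add: reads_Cons step_lookup lookup_rule_def scan_blank)
  then show ?case using Nil
    by (intro exI[of _ "Suc (2 * j)"] exI[of _ "None # tl z"]) (auto simp: blank_tl simp del: move_tape.simps)
next
  case (Cons b s)
  have r: "Suc (2 * j) \<in> X" "(Suc (Suc (Suc (2 * j))) \<in> X) = b" "reads X (j + 2) (delimited s)"
    using Cons.prems(1) by (auto simp add: reads_Cons)
  have z1: "blank_cells (scan (Some b # l, tl z) # tl (tl z))"
    using Cons.prems(2) blank_tl[of "tl z"] blank_tl[of z] by (simp add: scan_blank)
  obtain h z'' where z'': "blank_cells z''" "lookup_reach X (13, Suc (2 * (j + 2)), [(Some b # l, scan (Some b # l, tl z) # tl (tl z))])
     (18, h, [move_tape MoveL (map Some (rev s) @ Some b # l, z'')])"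
    using Cons.IH[OF r(3) z1] by blast
  have "lookup_reach X (13, Suc (2 * j), [(l, z)])
     (18, h, [move_tape MoveL (map Some (rev (b # s)) @ l, z'')])"
    apply (rule reach_step, use r in \<open>simp add: step_lookup lookup_rule_def\<close>)
    apply (rule reach_step, rule pending_step, simp, simp)
    apply (rule reach_step, use r in \<open>simp add: step_lookup lookup_rule_def\<close>)
    apply (rule reach_step, rule pending_step, simp, simp)
    using z''(2) apply simp
    done
  then show ?case using z''(1) by blast
qed

lemma reach_output:
  "lookup_reach X (18, h, [move_tape MoveL (map Some u @ None # l, r)]) (20, h, [(None # l, map Some (rev u) @ r)])"
proof (induction u arbitrary: r)
  case Nil
  show ?case
    by (rule reach_step[OF _ rtranclp.rtrancl_refl]) (simp add: step_lookup lookup_rule_def)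
next
  case (Cons x u)
  show ?case
    apply (rule reach_step[of _ _ "(18, h, [move_tape MoveL (map Some u @ None # l, Some x # r)])"])
     apply (simp add: step_lookup lookup_rule_def)
    using Cons.IH[of "Some x # r"] by simp
qed

abbreviation entry :: "bool list \<times> bool list \<Rightarrow> bool list" where
  "entry \<equiv> \<lambda>(p, s). delimited p @ delimited s"

lemma reach_skip_entries:
  assumes "reads X j (concat (map entry es))" "\<forall>(p, s) \<in> set es. \<not> prefix p v \<and> \<not> prefix v p"
    "l = [] \<or> l = [None]"
  shows "\<exists>l'. (l' = [] \<or> l' = [None]) \<and> lookup_reach X (1, Suc (2 * j), [(l, map Some v @ z)])
     (1, Suc (2 * (j + length (concat (map entry es)))), [(l', map Some v @ z)])"
  using assms
proof (induction es arbitrary: j l)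
  case Nil
  then show ?case by auto
next
  case (Cons e es)
  obtain p s where e: "e = (p, s)" by fastforce
  have r: "reads X j (delimited p)" "reads X (j + length (delimited p)) (delimited s)"
    "reads X (j + length (entry e)) (concat (map entry es))"
    using Cons.prems(1) e by (auto simp: reads_append add.assoc)
  have np: "\<not> prefix p v" "\<not> prefix v p" using Cons.prems(2) e by auto
  obtain a v' where v: "v = a # v'" using np by (cases v) auto
  obtain l' where l': "l' = [] \<or> l' = [None]" "lookup_reach X (1, Suc (2 * (j + length (entry e))), [([None], map Some v @ z)])
     (1, Suc (2 * (j + length (entry e) + length (concat (map entry es)))), [(l', map Some v @ z)])"
    using Cons.IH[OF r(3), of "[None]"] Cons.prems(2) by auto
  have "lookup_reach X (1, Suc (2 * j), [(l, map Some v @ z)])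
     (9, Suc (2 * (j + length (delimited p))), [([None], map Some v @ z)])"
    using reach_mismatch[OF r(1) np Cons.prems(3), of "[]" z] by simp
  also have "lookup_reach X \<dots>  (1, Suc (2 * (j + length (entry e))), [([None], map Some v @ z)])"
    using reach_skip2[OF r(2)] v e by (simp add: add.assoc)
  also note l'(2)
  finally show ?case using l'(1) by (auto simp: add.assoc)
qed

lemma computes_lookup:
  assumes "reads X 0 (concat (map entry es) @ entry (v, s))"
    "\<forall>(p, s) \<in> set es. \<not> prefix p v \<and> \<not> prefix v p"
  shows "computes lookup_machine X v s"
proof -
  define j where "j = length (concat (map entry es))"
  have r: "reads X 0 (concat (map entry es))" "reads X j (delimited v)" "reads X (j + length (delimited v)) (delimited s)"
    using assms(1) by (auto simp: reads_append j_def)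
  obtain z where z: "blank_cells z" "scan ([], map Some v @ []) # tl (map Some v @ []) = map Some v @ z"
    by (rule touch_blank[of "[]"]) auto
  obtain l where l: "lookup_reach X (1, Suc (2 * 0), [([], map Some v @ z)])
     (1, Suc (2 * (0 + j)), [(l, map Some v @ z)])"
    using reach_skip_entries[OF r(1) assms(2), of "[]" z] unfolding j_def by blast
  obtain z1 where z1: "blank_cells z1" "lookup_reach X (1, Suc (2 * j), [(l, map Some v @ z)])
     (17, 2 * (j + length (delimited v)), [(map Some (rev v) @ l, z1)])"
    using reach_match[OF r(2) z(1)] by blast
  \<comment> \<open>The leading \<open>None\<close> is the blank that state 17 crosses. It separates
    the input from the output and stops the leftward move of state 18 at the start of the
    output.\<close>
  let ?l = "None # map Some (rev v) @ l" and ?j = "j + length (delimited v)"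
  have z2: "blank_cells (scan (?l, tl z1) # tl (tl z1))" using z1(1) blank_tl[of "tl z1"] blank_tl[of z1] by (simp add: scan_blank)
  obtain h z3 where z3: "blank_cells z3" "lookup_reach X (13, Suc (2 * ?j), [(?l, scan (?l, tl z1) # tl (tl z1))])
     (18, h, [move_tape MoveL (map Some (rev s) @ ?l, z3)])"
    using reach_copy[OF r(3) z2] by blast
  have "lookup_reach X (init_config lookup_machine v) (1, Suc (2 * 0), [([], map Some v @ z)])"
    by (rule reach_step[OF _ rtranclp.rtrancl_refl])
      (use z(2) in \<open>simp add: init_config_lookup pending_step\<close>)
  also note l
  also have "lookup_reach X (1, Suc (2 * (0 + j)), [(l, map Some v @ z)]) (17, 2 * ?j, [(map Some (rev v) @ l, z1)])"
    using z1(2) by simp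
  also have "lookup_reach X \<dots> (13, Suc (2 * ?j), [(?l, scan (?l, tl z1) # tl (tl z1))])"
    apply (rule reach_step, use z1(1) in \<open>simp add: step_lookup lookup_rule_def scan_blank\<close>)
    apply (rule reach_step, rule pending_step, simp, simp)
    apply simp
    done
  also note z3(2)
  also have "lookup_reach X (18, h, [move_tape MoveL (map Some (rev s) @ ?l, z3)]) (20, h, [(?l, map Some (rev (rev s)) @ z3)])"
    by (rule reach_output)
  finally have "lookup_reach X (init_config lookup_machine v) (20, h, [(?l, map Some s @ z3)])" by simp
  moreover have "step lookup_machine X (20, h, [(?l, map Some s @ z3)]) = None"
    by (simp add: step_lookup lookup_rule_def)
  moreover have "tape_output (20, h, [(?l, map Some s @ z3)]) = s"
  proof -
    have "takeWhile (\<lambda>x. x \<noteq> None) (map Some s @ z3) = map Some s @ takeWhile (\<lambda>x. x \<noteq> None) z3"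
      by (rule takeWhile_append2) auto
    also have "takeWhile (\<lambda>x. x \<noteq> None) z3 = []" using z3(1) by (cases z3) auto
    finally show ?thesis by (simp add: comp_def)
  qed
  ultimately show ?thesis unfolding computes_def by blast
qed

text \<open>\<open>B\<close> is the limit of the tables \<open>S n\<close>, which list the entries
  for \<open>P\<close> along an enumeration. The machine ignores the even cells, so one
  \<open>B\<close> serves all \<open>A\<close>.\<close>

lemma lookup_oracle:
  fixes P :: "bool list set" and g :: "bool list \<Rightarrow> bool list"
  assumes "\<And>p p'. p \<in> P \<Longrightarrow> p' \<in> P \<Longrightarrow> prefix p p' \<Longrightarrow> p = p'"
  shows "\<exists>B. \<forall>A. \<forall>p\<in>P. computes lookup_machine (A \<squnion>\<^sub>T B) p (g p)"
proof (cases "P = {}")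
  case False
  define f where "f = from_nat_into P"
  have f: "f i \<in> P" for i unfolding f_def using False by (rule from_nat_into)
  define S where "S = (\<lambda>n. concat (map (\<lambda>i. entry (f i, g (f i))) [0..<n]))"
  define B where "B = {j. \<exists>n. j < length (S n) \<and> S n ! j}"
  have S_prefix: "prefix (S m) (S n)" if "m \<le> n" for m n
  proof -
    have "[0..<n] = [0..<m] @ [m..<n]" using upt_add_eq_append[of 0 m "n - m"] that by simp
    then show ?thesis unfolding S_def by (simp add: prefix_def)
  qed
  have S_nth: "S m ! j = S n ! j" if "j < length (S m)" "j < length (S n)" for m n j
    using that S_prefix[of m n] S_prefix[of n m] by (metis nle_le prefix_def nth_append)
  have reads: "reads (A \<squnion>\<^sub>T B) 0 (S n)" for A n
  proof -
    have "(Suc (2 * k) \<in> A \<squnion>\<^sub>T B) = (k \<in> B)" for k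
      unfolding oracle_join_def by (auto; presburger)
    moreover have "(k \<in> B) = S n ! k" if "k < length (S n)" for k
      using that S_nth unfolding B_def by blast
    ultimately show ?thesis unfolding reads_def by simp
  qed
  have "computes lookup_machine (A \<squnion>\<^sub>T B) p (g p)" if p: "p \<in> P" for A p
  proof -
    obtain i0 where "f i0 = p" using p from_nat_into_surj[of P p] unfolding f_def by auto
    \<comment> \<open>The enumeration may repeat elements. At the first occurrence of
      \<open>p\<close> all earlier keys differ from \<open>p\<close>, hence are incomparable with it
      by prefix-freeness.\<close>
    define i where "i = (LEAST i. f i = p)"
    have i: "f i = p" unfolding i_def by (rule LeastI[of _ i0]) fact
    have less: "f k \<noteq> p" if "k < i" for k using that not_less_Least unfolding i_def by blast
    show ?thesis
    proof (rule computes_lookup[where es = "map (\<lambda>k. (f k, g (f k))) [0..<i]"])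
      show "reads (A \<squnion>\<^sub>T B) 0 (concat (map entry (map (\<lambda>k. (f k, g (f k))) [0..<i])) @ entry (p, g p))"
        using reads[of A "Suc i"] unfolding S_def by (simp add: i comp_def)
      show "\<forall>(p', s)\<in>set (map (\<lambda>k. (f k, g (f k))) [0..<i]). \<not> prefix p' p \<and> \<not> prefix p p'"
        using less assms f p by fastforce
    qed
  qed
  then show ?thesis by blast
qed auto

lemma KC_le_length: "computes M A \<pi> \<sigma> \<Longrightarrow> KC M A \<sigma> \<le> enat (length \<pi>)"
  unfolding KC_def by (rule INF_lower) simp

text \<open>Universality is applied to one fixed lookup machine, so the constant is chosen before
  \<open>P\<close>, \<open>g\<close> and both oracles.\<close>

lemma KC_oracle_code:
  assumes "universal_prefix_machine U"
  shows "\<exists>c::nat. \<forall>(P :: bool list set) g. (\<forall>p\<in>P. \<forall>p'\<in>P. prefix p p' \<longrightarrow> p = p') \<longrightarrow>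
     (\<exists>B. \<forall>A. \<forall>p\<in>P. KC U (A \<squnion>\<^sub>T B) (g p) \<le> enat (length p + c))"
proof -
  obtain c :: nat where c: "\<And>A \<sigma>. KC U A \<sigma> \<le> KC lookup_machine A \<sigma> + enat c"
    using assms prefix_machine_lookup unfolding universal_prefix_machine_def by blast
  show ?thesis
  proof (intro exI[of _ c] allI impI)
    fix P :: "bool list set" and g :: "bool list \<Rightarrow> bool list"
    assume pf: "\<forall>p\<in>P. \<forall>p'\<in>P. prefix p p' \<longrightarrow> p = p'"
    obtain B where B: "\<And>A p. p \<in> P \<Longrightarrow> computes lookup_machine (A \<squnion>\<^sub>T B) p (g p)"
      using lookup_oracle[of P, OF pf[rule_format], where g = g] by blast
    have "KC U (A \<squnion>\<^sub>T B) (g p) \<le> enat (length p + c)" if "p \<in> P" for A p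
    proof -
      have "KC U (A \<squnion>\<^sub>T B) (g p) \<le> KC lookup_machine (A \<squnion>\<^sub>T B) (g p) + enat c" by (rule c)
      also have "\<dots> \<le> enat (length p) + enat c"
        by (intro add_right_mono KC_le_length B that)
      finally show ?thesis by simp
    qed
    then show "\<exists>B. \<forall>A. \<forall>p\<in>P. KC U (A \<squnion>\<^sub>T B) (g p) \<le> enat (length p + c)" by blast
  qed
qed

section \<open>Hausdorff measure\<close>

lemma hausdorff_premeasure_le:
  assumes "E \<subseteq> (\<Union>i. C i)" "\<And>i. bounded (C i)" "\<And>i. diameter (C i) \<le> \<delta>"
  shows "hausdorff_premeasure s \<delta> E \<le> (\<Sum>i. ennreal (diameter (C i) powr s))"
  unfolding hausdorff_premeasure_def by (rule INF_lower) (use assms in auto)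

lemma hausdorff_premeasure_lessE:
  assumes "hausdorff_premeasure s \<delta> E < a"
  obtains C where "E \<subseteq> (\<Union>i. C i)" "\<And>i. bounded (C i)" "\<And>i. diameter (C i) \<le> \<delta>"
    "(\<Sum>i. ennreal (diameter (C i) powr s)) < a"
  using assms unfolding hausdorff_premeasure_def INF_less_iff by blast

lemma hausdorff_premeasure_mono:
  "E \<subseteq> F \<Longrightarrow> hausdorff_premeasure s \<delta> E \<le> hausdorff_premeasure s \<delta> F"
  unfolding hausdorff_premeasure_def by (rule INF_superset_mono) auto

lemma hausdorff_measure_mono:
  "E \<subseteq> F \<Longrightarrow> hausdorff_measure s E \<le> hausdorff_measure s F"
  unfolding hausdorff_measure_def by (intro SUP_mono) (blast intro: hausdorff_premeasure_mono)

text \<open>Near-optimal covers of the sets \<open>E n\<close>, with excess e / 2^(n+1), are merged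
  into a single sequence by the pairing function.\<close>

lemma hausdorff_premeasure_UN:
  "hausdorff_premeasure s \<delta> (\<Union>i. E i) \<le> (\<Sum>i. hausdorff_premeasure s \<delta> (E i))"
proof (rule ennreal_le_epsilon)
  fix e :: real assume e: "0 < e" and fin: "(\<Sum>i. hausdorff_premeasure s \<delta> (E i)) < top"
  have *: "hausdorff_premeasure s \<delta> (E n) < hausdorff_premeasure s \<delta> (E n) + e * (1/2)^Suc n" for n
    using fin e by (auto simp add: less_top dest!: ennreal_suminf_lessD)
  have "\<exists>C. E n \<subseteq> (\<Union>i. C i) \<and> (\<forall>i. bounded (C i) \<and> diameter (C i) \<le> \<delta>) \<and>
      (\<Sum>i. ennreal (diameter (C i) powr s)) \<le> hausdorff_premeasure s \<delta> (E n) + e * (1/2)^Suc n" for n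
    using hausdorff_premeasure_lessE[OF *[of n]] by (metis less_imp_le)
  then obtain B where B: "\<And>n. E n \<subseteq> (\<Union>i. B n i)"
      "\<And>n i. bounded (B n i)" "\<And>n i. diameter (B n i) \<le> \<delta>"
      "\<And>n. (\<Sum>i. ennreal (diameter (B n i) powr s)) \<le> hausdorff_premeasure s \<delta> (E n) + e * (1/2)^Suc n"
    by metis
  define C where "C = case_prod B \<circ> prod_decode"
  have "(\<Union>i. E i) \<subseteq> (\<Union>i. C i)"
    using B(1) by (auto simp add: C_def subset_eq) (metis prod.case prod_encode_inverse)
  then have "hausdorff_premeasure s \<delta> (\<Union>i. E i) \<le> (\<Sum>i. ennreal (diameter (C i) powr s))"
    by (rule hausdorff_premeasure_le) (auto simp: C_def split_def B)
  also have "\<dots> = (\<Sum>n. \<Sum>i. ennreal (diameter (B n i) powr s))"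
    unfolding C_def comp_def by (rule suminf_ennreal_2dimen[where f = "\<lambda>p. ennreal (diameter (case_prod B p) powr s)"]) simp
  also have "\<dots> \<le> (\<Sum>n. hausdorff_premeasure s \<delta> (E n) + e * (1/2) ^ Suc n)"
    by (intro suminf_le allI B) auto
  also have "\<dots> = (\<Sum>n. hausdorff_premeasure s \<delta> (E n)) + (\<Sum>n. ennreal e * ennreal ((1/2) ^ Suc n))"
    using e by (subst suminf_add[symmetric])
       (auto simp del: ennreal_suminf_cmult simp add: ennreal_mult[symmetric])
  also have "\<dots> = (\<Sum>n. hausdorff_premeasure s \<delta> (E n)) + e"
    unfolding ennreal_suminf_cmult
    by (subst suminf_ennreal_eq[OF zero_le_power power_half_series]) auto
  finally show "hausdorff_premeasure s \<delta> (\<Union>i. E i) \<le> (\<Sum>i. hausdorff_premeasure s \<delta> (E i)) + e" .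
qed

lemma hausdorff_measure_eq_0_iff:
  "hausdorff_measure s E = 0 \<longleftrightarrow> (\<forall>\<delta>>0. hausdorff_premeasure s \<delta> E = 0)"
proof -
  have "hausdorff_measure s E = 0 \<longleftrightarrow> (SUP \<delta> \<in> {0<..}. hausdorff_premeasure s \<delta> E) \<le> 0"
    by (simp add: hausdorff_measure_def)
  also have "\<dots> \<longleftrightarrow> (\<forall>\<delta>>0. hausdorff_premeasure s \<delta> E = 0)"
    by (subst SUP_le_iff) auto
  finally show ?thesis .
qed

lemma hausdorff_measure_UN_null:
  fixes E :: "nat \<Rightarrow> 'a::metric_space set"
  assumes "\<And>i. hausdorff_measure s (E i) = 0"
  shows "hausdorff_measure s (\<Union>i. E i) = 0"
  unfolding hausdorff_measure_eq_0_iff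
proof (intro allI impI)
  fix \<delta> :: real assume "\<delta> > 0"
  then have "(\<Sum>i. hausdorff_premeasure s \<delta> (E i)) = 0"
    using assms by (simp add: hausdorff_measure_eq_0_iff)
  then show "hausdorff_premeasure s \<delta> (\<Union>i. E i) = 0"
    using hausdorff_premeasure_UN[of s \<delta> E] by simp
qed

lemma hausdorff_premeasure_bounded:
  assumes "bounded S" "diameter S \<le> \<delta>" "\<delta> > 0"
  shows "hausdorff_premeasure s \<delta> S \<le> ennreal (diameter S powr s)"
proof -
  \<comment> \<open>The cover is padded with empty sets, which cost nothing because
    \<open>0 powr s = 0\<close> holds even for \<open>s = 0\<close>.\<close>
  have "hausdorff_premeasure s \<delta> S \<le> (\<Sum>i. ennreal (diameter (if i = (0::nat) then S else {}) powr s))"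
    by (rule hausdorff_premeasure_le) (use assms in auto)
  also have "\<dots> = (\<Sum>i\<in>{0::nat}. ennreal (diameter (if i = (0::nat) then S else {}) powr s))"
    by (rule suminf_finite) auto
  finally show ?thesis by simp
qed

lemma hausdorff_premeasure_empty: "\<delta> > 0 \<Longrightarrow> hausdorff_premeasure s \<delta> {} = 0"
  using hausdorff_premeasure_bounded[of "{}" \<delta> s] by simp

lemma hausdorff_premeasure_finite_UN:
  assumes "finite I" "\<delta> > 0"
  shows "hausdorff_premeasure s \<delta> (\<Union>i\<in>I. E i) \<le> (\<Sum>i\<in>I. hausdorff_premeasure s \<delta> (E i))"
  using assms(1)
proof (induction I rule: finite_induct)
  case empty
  then show ?case by (simp add: hausdorff_premeasure_empty assms)
next
  case (insert j I)
  define G where "G = (\<lambda>n::nat. if n = 0 then E j else if n = 1 then (\<Union>i\<in>I. E i) else {})"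
  have "(\<Union>i\<in>insert j I. E i) = (\<Union>n. G n)" by (auto simp: G_def split: if_splits)
  then have "hausdorff_premeasure s \<delta> (\<Union>i\<in>insert j I. E i) \<le> (\<Sum>n. hausdorff_premeasure s \<delta> (G n))"
    using hausdorff_premeasure_UN[of s \<delta> G] by simp
  also have "\<dots> = (\<Sum>n\<in>{0, 1}. hausdorff_premeasure s \<delta> (G n))"
    by (rule suminf_finite) (auto simp: G_def hausdorff_premeasure_empty assms)
  also have "\<dots> = hausdorff_premeasure s \<delta> (E j) + hausdorff_premeasure s \<delta> (\<Union>i\<in>I. E i)"
    by (simp add: G_def)
  finally show ?case using insert by (auto intro: order_trans add_left_mono)
qed

section \<open>Limit superior sets and dyadic nets\<close>

lemma diameter_cball_le:
  fixes z :: "'a::real_normed_vector"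
  assumes "0 \<le> \<rho>" shows "diameter (cball z \<rho>) \<le> 2 * \<rho>"
proof (rule diameter_le)
  fix x y assume "x \<in> cball z \<rho>" "y \<in> cball z \<rho>"
  then show "norm (x - y) \<le> 2 * \<rho>"
    using dist_triangle_le[of x z y "2 * \<rho>"] by (simp add: dist_norm norm_minus_commute)
qed (use assms in auto)

text \<open>The convergence half of Borel-Cantelli: beyond any index the balls still cover
  \<open>D\<close>, at the cost of a tail of a convergent series.\<close>

lemma hausdorff_measure_limsup_null:
  fixes Z :: "nat \<Rightarrow> 'a::real_normed_vector set"
  assumes fin: "\<And>r. finite (Z r)" and pos: "\<And>r. 0 \<le> \<rho> r" "0 < t"
    and lim: "\<rho> \<longlonglongrightarrow> 0"
    and sum: "summable (\<lambda>r. real (card (Z r)) * (2 * \<rho> r) powr t)"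
    and cov: "\<And>x. x \<in> D \<Longrightarrow> \<exists>\<^sub>F r in sequentially. \<exists>z\<in>Z r. dist z x \<le> \<rho> r"
  shows "hausdorff_measure t D = 0"
  unfolding hausdorff_measure_eq_0_iff
proof (intro allI impI)
  fix \<delta> :: real assume \<delta>: "\<delta> > 0"
  have "hausdorff_premeasure t \<delta> D \<le> 0"
  proof (rule ennreal_le_epsilon)
    fix e :: real assume e: "0 < e"
    obtain N1 where N1: "\<And>n. n \<ge> N1 \<Longrightarrow> norm (\<Sum>i. real (card (Z (i + n))) * (2 * \<rho> (i + n)) powr t) < e"
      using suminf_exist_split[OF e sum] by auto
    have "eventually (\<lambda>r. \<rho> r < \<delta> / 2) sequentially"
      using order_tendstoD(2)[OF lim, of "\<delta> / 2"] \<delta> by simp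
    then obtain N2 where N2: "\<And>r. r \<ge> N2 \<Longrightarrow> \<rho> r < \<delta> / 2" unfolding eventually_sequentially by blast
    \<comment> \<open>\<open>N1\<close> makes the tail smaller than \<open>e\<close>,
      \<open>N2\<close> makes the balls admissible at scale \<open>\<delta>\<close>.\<close>
    define N where "N = max N1 N2"
    define G where "G = (\<lambda>r. \<Union>z\<in>Z (r + N). cball z (\<rho> (r + N)))"
    have "D \<subseteq> (\<Union>r. G r)"
    proof
      fix x assume "x \<in> D"
      from cov[OF this] obtain r where r: "r \<ge> N" "\<exists>z\<in>Z r. dist z x \<le> \<rho> r"
        unfolding frequently_sequentially by blast
      then show "x \<in> (\<Union>r. G r)" unfolding G_def by (auto intro!: exI[of _ "r - N"])
    qed
    then have "hausdorff_premeasure t \<delta> D \<le> (\<Sum>r. hausdorff_premeasure t \<delta> (G r))"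
      using hausdorff_premeasure_mono[of D "\<Union>r. G r"] hausdorff_premeasure_UN[of t \<delta> G] by (meson order_trans)
    also have "\<dots> \<le> (\<Sum>r. ennreal (real (card (Z (r + N))) * (2 * \<rho> (r + N)) powr t))"
    proof (intro suminf_le allI)
      fix r
      have small: "2 * \<rho> (r + N) \<le> \<delta>" 
      proof -
        have "N2 \<le> r + N" unfolding N_def by linarith
        from N2[OF this] show ?thesis by simp
      qed
      have one: "hausdorff_premeasure t \<delta> (cball z (\<rho> (r + N))) \<le> ennreal ((2 * \<rho> (r + N)) powr t)" for z :: 'a
      proof -
        have d: "diameter (cball z (\<rho> (r + N))) \<le> 2 * \<rho> (r + N)" by (rule diameter_cball_le[OF pos(1)])
        then have "hausdorff_premeasure t \<delta> (cball z (\<rho> (r + N))) \<le> ennreal (diameter (cball z (\<rho> (r + N))) powr t)"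
          using small \<delta> by (intro hausdorff_premeasure_bounded) auto
        also have "\<dots> \<le> ennreal ((2 * \<rho> (r + N)) powr t)"
          using d pos(2) by (intro ennreal_leI powr_mono2 diameter_ge_0) auto
        finally show ?thesis .
      qed
      have "hausdorff_premeasure t \<delta> (G r) \<le> (\<Sum>z\<in>Z (r + N). hausdorff_premeasure t \<delta> (cball z (\<rho> (r + N))))"
        unfolding G_def by (rule hausdorff_premeasure_finite_UN[OF fin \<delta>])
      also have "\<dots> \<le> (\<Sum>z\<in>Z (r + N). ennreal ((2 * \<rho> (r + N)) powr t))"
        by (intro sum_mono one)
      also have "\<dots> = ennreal (real (card (Z (r + N))) * (2 * \<rho> (r + N)) powr t)"
        by (simp add: ennreal_mult ennreal_of_nat_eq_real_of_nat)
      finally show "hausdorff_premeasure t \<delta> (G r) \<le> ennreal (real (card (Z (r + N))) * (2 * \<rho> (r + N)) powr t)" .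
    qed auto
    also have "\<dots> = ennreal (\<Sum>r. real (card (Z (r + N))) * (2 * \<rho> (r + N)) powr t)"
      by (rule suminf_ennreal2) (use sum in \<open>auto simp: summable_iff_shift[of "\<lambda>r. real (card (Z r)) * (2 * \<rho> r) powr t"]\<close>)
    also have "\<dots> \<le> ennreal e"
      using N1[of N] by (intro ennreal_leI) (simp add: N_def)
    finally show "hausdorff_premeasure t \<delta> D \<le> 0 + ennreal e" by simp
  qed
  then show "hausdorff_premeasure t \<delta> D = 0" by simp
qed

text \<open>For positive \<open>d\<close> the scale is the \<open>R\<close> with 2^-(R+1) < d \<le>
  2^-R. A set of diameter 0 has no such scale; there \<open>R\<close> is made so large that its cost
  is at most (1/2)^m, which is summable when \<open>m\<close> is the index of the set in its
  cover.\<close>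

lemma dyadic_scale_exists:
  assumes "0 < s" "0 \<le> d" "d \<le> 1 / 2 ^ k"
  shows "\<exists>R\<ge>k. d \<le> 1 / 2 ^ R \<and> 2 powr (- (s * real R)) \<le> 2 powr s * d powr s + (1 / 2) ^ m"
proof (cases "d = 0")
  case True
  define R where "R = k + nat \<lceil>real m / s\<rceil>"
  have "real m / s \<le> real R" unfolding R_def by linarith
  then have "real m \<le> s * real R" using assms(1) by (simp add: field_simps)
  then have "2 powr (- (s * real R)) \<le> 2 powr (- real m)" by simp
  also have "\<dots> = (1 / 2) ^ m" by (simp add: powr_minus powr_realpow power_one_over inverse_eq_divide)
  finally show ?thesis using True by (intro exI[of _ R]) (auto simp: R_def)
next
  case False
  then have d: "d > 0" using assms(2) by simp
  define R where "R = nat \<lfloor>- log 2 d\<rfloor>"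
  have "log 2 d \<le> log 2 (1 / 2 ^ k)" using d assms(3) by (subst log_le_cancel_iff) auto
  then have k: "real k \<le> - log 2 d" by (simp add: log_divide)
  then have R: "real R \<le> - log 2 d" "- log 2 d < real R + 1" "k \<le> R"
    unfolding R_def by linarith+
  have e: "d powr s = 2 powr (s * log 2 d)" using d by (simp add: powr_powr[symmetric] mult.commute[of s])
  have "d = 2 powr (log 2 d)" using d by simp
  also have "\<dots> \<le> 2 powr (- real R)" using R by simp
  also have "\<dots> = 1 / 2 ^ R" by (simp add: powr_minus powr_realpow inverse_eq_divide)
  finally have "d \<le> 1 / 2 ^ R" .
  moreover have "- (s * real R) \<le> s + s * log 2 d"
  proof -
    have "s * (- log 2 d) \<le> s * (real R + 1)" using R assms(1) by (intro mult_left_mono) auto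
    then show ?thesis by (simp add: algebra_simps)
  qed
  then have "2 powr (- (s * real R)) \<le> 2 powr s * d powr s"
    unfolding e powr_add[symmetric] by simp
  ultimately show ?thesis using R(3) by (intro exI[of _ R]) (auto intro: order_trans)
qed

text \<open>For each \<open>k\<close>, a cover by sets of diameter at most 2^-k and of cost below 1
  is sorted by dyadic scale; the cost bounds the number of sets of scale \<open>r\<close> by a
  constant times 2^(s r). One point is chosen from each set. A point of \<open>X\<close> lies in a
  set of every cover, and scales in the \<open>k\<close>-th cover are at least \<open>k\<close>, so
  it is approximated at infinitely many scales.\<close>

lemma hausdorff_null_dyadic_nets:
  fixes X :: "'a::metric_space set"
  assumes null: "hausdorff_measure s X = 0" and s: "0 < s" "s < s'"
  obtains Y where "\<forall>\<^sub>F r in sequentially. finite (Y r) \<and> real (card (Y r)) \<le> 2 powr (s' * real r)"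
    "\<And>x. x \<in> X \<Longrightarrow> \<exists>\<^sub>F r in sequentially. \<exists>y\<in>Y r. dist x y \<le> 1 / 2 ^ r"
proof -
  have "\<exists>C. X \<subseteq> (\<Union>i. C i) \<and> (\<forall>i. bounded (C i) \<and> diameter (C i) \<le> 1 / 2 ^ k) \<and>
      (\<Sum>i. ennreal (diameter (C i) powr s)) < 1" for k :: nat
  proof -
    have "hausdorff_premeasure s (1 / 2 ^ k) X < 1"
      using null unfolding hausdorff_measure_eq_0_iff by simp
    then show ?thesis by (rule hausdorff_premeasure_lessE) blast
  qed
  then obtain C where C: "\<And>k. X \<subseteq> (\<Union>i. C k i)" "\<And>k i. bounded (C k i)" "\<And>k i. diameter (C k i) \<le> 1 / 2 ^ k"
    "\<And>k. (\<Sum>i. ennreal (diameter (C k i) powr s)) < 1"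
    by metis
  have "\<exists>R\<ge>k. diameter (C k i) \<le> 1 / 2 ^ R \<and>
      2 powr (- (s * real R)) \<le> 2 powr s * diameter (C k i) powr s + (1 / 2) ^ i" for k i
    using s(1) diameter_ge_0[OF C(2)[of k i]] C(3)[of k i] by (rule dyadic_scale_exists)
  then obtain R where R: "\<And>k i. k \<le> R k i" "\<And>k i. diameter (C k i) \<le> 1 / 2 ^ R k i"
    "\<And>k i. 2 powr (- (s * real (R k i))) \<le> 2 powr s * diameter (C k i) powr s + (1 / 2) ^ i"
    by metis
  define I where "I = (\<lambda>k r. {i. R k i = r})"
  \<comment> \<open>The first term comes from the cost of the cover, the second from the geometric
    series of the errors.\<close>
  define M where "M = 2 powr s + 2"
  have bound: "real (card F) \<le> M * 2 powr (s * real r)" if F: "F \<subseteq> I k r" "finite F" for F k r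
  proof -
    have "(\<Sum>i\<in>F. ennreal (diameter (C k i) powr s)) \<le> (\<Sum>i. ennreal (diameter (C k i) powr s))"
      by (rule sum_le_suminf) (use F in auto)
    also have "\<dots> \<le> ennreal 1" using C(4)[of k] by simp
    finally have 1: "(\<Sum>i\<in>F. diameter (C k i) powr s) \<le> 1"
      by (subst (asm) sum_ennreal) (auto simp: sum_nonneg)
    have "(\<Sum>i\<in>F. (1 / 2 :: real) ^ i) \<le> (\<Sum>i. (1 / 2) ^ i)"
      by (rule sum_le_suminf) (use F in \<open>auto intro: summable_geometric\<close>)
    also have "\<dots> = 2" by (simp add: suminf_geometric)
    finally have 2: "(\<Sum>i\<in>F. (1 / 2 :: real) ^ i) \<le> 2" .
    have "real (card F) * 2 powr (- (s * real r)) = (\<Sum>i\<in>F. 2 powr (- (s * real (R k i))))"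
    proof -
      have "(\<Sum>i\<in>F. 2 powr (- (s * real (R k i)))) = (\<Sum>i\<in>F. 2 powr (- (s * real r)))"
        by (rule sum.cong) (use F(1) in \<open>auto simp: I_def\<close>)
      then show ?thesis by simp
    qed
    also have "\<dots> \<le> (\<Sum>i\<in>F. 2 powr s * diameter (C k i) powr s + (1 / 2) ^ i)"
      by (intro sum_mono R)
    also have "\<dots> = 2 powr s * (\<Sum>i\<in>F. diameter (C k i) powr s) + (\<Sum>i\<in>F. (1 / 2) ^ i)"
      by (simp add: sum.distrib sum_distrib_left)
    also have "\<dots> \<le> 2 powr s * 1 + 2"
      by (intro add_mono mult_left_mono 1 2) auto
    finally have "real (card F) * 2 powr (- (s * real r)) * 2 powr (s * real r) \<le> M * 2 powr (s * real r)"
      unfolding M_def by (intro mult_right_mono) auto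
    then show ?thesis by (simp add: mult.assoc powr_add[symmetric])
  qed
  have I: "finite (I k r)" "real (card (I k r)) \<le> M * 2 powr (s * real r)" for k r
  proof -
    have "finite (I k r) \<and> card (I k r) \<le> nat \<lfloor>M * 2 powr (s * real r)\<rfloor>"
      by (rule finite_if_finite_subsets_card_bdd) (use bound[of _ k r] in \<open>simp add: le_nat_floor\<close>)
    then show "finite (I k r)" by simp
    then show "real (card (I k r)) \<le> M * 2 powr (s * real r)" by (intro bound) auto
  qed
  \<comment> \<open>Scales in the \<open>k\<close>-th cover are at least \<open>k\<close>, so only
    covers with \<open>k \<le> r\<close> contribute; the resulting factor \<open>r + 1\<close> is
    absorbed by \<open>s' > s\<close>.\<close>
  define Y where "Y = (\<lambda>r. (\<lambda>(k, i). SOME y. y \<in> C k i) ` (SIGMA k:{..r}. I k r))"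
  have fin: "finite (Y r)" for r unfolding Y_def using I by auto
  have card: "real (card (Y r)) \<le> (real r + 1) * (M * 2 powr (s * real r))" for r
  proof -
    have "card (Y r) \<le> card (SIGMA k:{..r}. I k r)" unfolding Y_def by (rule card_image_le) (use I in auto)
    also have "\<dots> = (\<Sum>k\<le>r. card (I k r))" using I by simp
    finally have "real (card (Y r)) \<le> (\<Sum>k\<le>r. real (card (I k r)))" by (metis of_nat_le_iff of_nat_sum)
    also have "\<dots> \<le> (\<Sum>k\<le>r. M * 2 powr (s * real r))" by (intro sum_mono I)
    finally show ?thesis by (simp add: algebra_simps)
  qed
  have M: "M > 0" unfolding M_def by (simp add: add_pos_pos)
  have "eventually (\<lambda>r. (real r + 1) * M \<le> 2 powr ((s' - s) * real r)) sequentially"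
    using s M by real_asymp
  then have "\<forall>\<^sub>F r in sequentially. finite (Y r) \<and> real (card (Y r)) \<le> 2 powr (s' * real r)"
  proof (rule eventually_mono)
    fix r assume *: "(real r + 1) * M \<le> 2 powr ((s' - s) * real r)"
    have "real (card (Y r)) \<le> (real r + 1) * M * 2 powr (s * real r)" using card[of r] by (simp add: mult.assoc)
    also have "\<dots> \<le> 2 powr ((s' - s) * real r) * 2 powr (s * real r)" by (intro mult_right_mono *) auto
    also have "\<dots> = 2 powr (s' * real r)" by (simp add: powr_add[symmetric] algebra_simps)
    finally show "finite (Y r) \<and> real (card (Y r)) \<le> 2 powr (s' * real r)" using fin by simp
  qed
  moreover have "\<exists>\<^sub>F r in sequentially. \<exists>y\<in>Y r. dist x y \<le> 1 / 2 ^ r" if x: "x \<in> X" for x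
    unfolding frequently_sequentially
  proof
    fix N
    obtain i where i: "x \<in> C N i" using C(1)[of N] x by blast
    define y where "y = (SOME y. y \<in> C N i)"
    have y: "y \<in> C N i" unfolding y_def using i by (rule someI)
    have "dist x y \<le> 1 / 2 ^ R N i"
      using diameter_bounded_bound[OF C(2) i y] R(2)[of N i] by linarith
    moreover have "y \<in> Y (R N i)"
      unfolding Y_def y_def using R(1)[of N i] by (force simp: I_def)
    ultimately show "\<exists>r\<ge>N. \<exists>y\<in>Y r. dist x y \<le> 1 / 2 ^ r" using R(1)[of N i] by blast
  qed
  ultimately show thesis by (rule that)
qed

lemma hausdorff_dim_le:
  assumes "0 < t" "hausdorff_measure t X = 0"
  shows "hausdorff_dim X \<le> ereal t"
proof -
  have "ereal t \<in> {ereal s |s. 0 < s \<and> hausdorff_measure s X = 0}"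
    using assms by blast
  then show ?thesis unfolding hausdorff_dim_def by (rule Inf_lower)
qed

lemma hausdorff_dim_nonneg: "0 \<le> hausdorff_dim X"
  unfolding hausdorff_dim_def by (rule Inf_greatest) auto

section \<open>Counting and tabulating strings\<close>

lemma delimited_append_inject:
  "delimited u @ v = delimited u' @ v' \<longleftrightarrow> u = u' \<and> v = v'"
proof (induction u arbitrary: u')
  case Nil
  then show ?case by (cases u') auto
next
  case (Cons b u)
  then show ?case by (cases u') auto
qed

lemma binary_inject: "binary m = binary n \<longleftrightarrow> m = n"
proof
  show "m = n" if "binary m = binary n"
    using that
  proof (induction m arbitrary: n rule: less_induct)
    case (less m)
    show ?case
    proof (cases "m = 0 \<or> n = 0")
      case True
      then show ?thesis using less.prems by (auto simp: binary.simps[of m] binary.simps[of n] split: if_splits)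
    next
      case False
      then have "odd m = odd n" "binary (m div 2) = binary (n div 2)"
        using less.prems by (auto simp: binary.simps[of m] binary.simps[of n])
      moreover from this(2) have "m div 2 = n div 2" using False by (intro less.IH) auto
      ultimately show ?thesis by (metis even_two_times_div_two odd_two_times_div_two_succ)
    qed
  qed
qed simp

lemma length_binary_le: "n < 2 ^ m \<Longrightarrow> length (binary n) \<le> m"
proof (induction m arbitrary: n)
  case 0
  then show ?case by (simp add: binary.simps[of 0])
next
  case (Suc m)
  then show ?case by (cases "n = 0") (auto simp: binary.simps[of 0] binary.simps[of n])
qed

lemma length_binary_le_log: "real (length (binary n)) \<le> log 2 (real n + 1) + 1"
proof -
  define m where "m = nat \<lceil>log 2 (real n + 1)\<rceil>"
  have "log 2 (real n + 1) \<le> real m" unfolding m_def by linarith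
  then have "real n + 1 \<le> 2 powr real m" by (subst (asm) log_le_iff) auto
  then have "real (n + 1) \<le> real (2 ^ m)" by (simp add: powr_realpow)
  then have "n < 2 ^ m" unfolding of_nat_le_iff by simp
  then have "length (binary n) \<le> m" by (rule length_binary_le)
  moreover have "0 \<le> log 2 (real n + 1)" by simp
  then have "real m \<le> log 2 (real n + 1) + 1" unfolding m_def by linarith
  ultimately show ?thesis by linarith
qed

lemma length_delimited: "length (delimited u) = 2 * length u + 1"
  by (induction u) auto

lemma encode_rat_append_inject: "encode_rat a @ v = encode_rat b @ w \<longleftrightarrow> a = b \<and> v = w"
proof
  assume *: "encode_rat a @ v = encode_rat b @ w"
  obtain p q where a: "quotient_of a = (p, q)" by fastforce
  obtain p' q' where b: "quotient_of b = (p', q')" by fastforce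
  have "q > 0" "q' > 0" using quotient_of_denom_pos a b by auto
  moreover have "(p < 0) = (p' < 0)" "nat \<bar>p\<bar> = nat \<bar>p'\<bar>" "nat q = nat q'" "v = w"
    using * by (auto simp: encode_rat_def a b delimited_append_inject binary_inject)
  ultimately have "p = p'" "q = q'" "v = w" by auto
  then show "a = b \<and> v = w" using a b by (metis quotient_of_inject)
qed simp

lemma inj_encode_vec: "inj encode_vec"
proof
  have map_eq: "map f is = map g is" if "concat (map (\<lambda>i. encode_rat (f i)) is) = concat (map (\<lambda>i. encode_rat (g i)) is)"
    for f g :: "'i \<Rightarrow> rat" and "is"
    using that by (induction "is") (auto simp: encode_rat_append_inject)
  fix p q :: "rat ^ 'n::{finite, linorder}" assume "encode_vec p = encode_vec q"
  from map_eq[OF this[unfolded encode_vec_def]] show "p = q"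
    by (simp add: vec_eq_iff)
qed

section \<open>Counting strings and vectors of small complexity\<close>

lemma card_short_programs: "finite {\<pi> :: bool list. length \<pi> \<le> n}" "card {\<pi> :: bool list. length \<pi> \<le> n} \<le> 2 ^ (n + 1)"
proof -
  have "finite {\<pi> :: bool list. set \<pi> \<subseteq> UNIV \<and> length \<pi> \<le> n}" by (rule finite_lists_length_le) simp
  then show "finite {\<pi> :: bool list. length \<pi> \<le> n}" by simp
  have "card {\<pi> :: bool list. set \<pi> \<subseteq> UNIV \<and> length \<pi> \<le> n} = (\<Sum>i\<le>n. card (UNIV :: bool set) ^ i)"
    by (rule card_lists_length_le) simp
  also have "\<dots> \<le> 2 ^ (n + 1)" by (induction n) auto
  finally show "card {\<pi> :: bool list. length \<pi> \<le> n} \<le> 2 ^ (n + 1)" by simp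
qed

text \<open>Computation is deterministic, so choosing for each string one program of length at most
  \<open>n\<close> is injective.\<close>

lemma card_KC_le:
  "finite {\<sigma>. KC M A \<sigma> \<le> enat n}" "card {\<sigma>. KC M A \<sigma> \<le> enat n} \<le> 2 ^ (n + 1)"
proof -
  let ?S = "{\<sigma>. KC M A \<sigma> \<le> enat n}" and ?P = "{\<pi> :: bool list. length \<pi> \<le> n}"
  define f where "f = (\<lambda>\<sigma>. SOME \<pi>. computes M A \<pi> \<sigma> \<and> length \<pi> \<le> n)"
  have f: "computes M A (f \<sigma>) \<sigma> \<and> length (f \<sigma>) \<le> n" if "\<sigma> \<in> ?S" for \<sigma>
  proof -
    have "KC M A \<sigma> < enat (Suc n)" using that by (simp add: order_le_less_trans[of _ "enat n"])
    then have "\<exists>\<pi>. computes M A \<pi> \<sigma> \<and> length \<pi> \<le> n"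
      unfolding KC_def INF_less_iff by auto
    then show ?thesis unfolding f_def by (rule someI_ex)
  qed
  have "inj_on f ?S" by (rule inj_onI) (metis f computes_functional)
  moreover have "f ` ?S \<subseteq> ?P" using f by auto
  ultimately have "finite ?S \<and> card ?S \<le> card ?P"
    using card_short_programs(1) by (meson card_inj_on_le inj_on_finite)
  then show "finite ?S" "card ?S \<le> 2 ^ (n + 1)" using card_short_programs(2)[of n] by auto
qed

lemma card_KC_vec_le:
  "finite {q :: rat ^ 'n::{finite, linorder}. KC M A (encode_vec q) \<le> enat n}" "card {q :: rat ^ 'n::{finite, linorder}. KC M A (encode_vec q) \<le> enat n} \<le> 2 ^ (n + 1)"
proof -
  let ?Q = "{q :: rat ^ 'n::{finite, linorder}. KC M A (encode_vec q) \<le> enat n}"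
  have *: "inj_on encode_vec ?Q" "encode_vec ` ?Q \<subseteq> {\<sigma>. KC M A \<sigma> \<le> enat n}"
    using inj_encode_vec by (auto simp: inj_on_def)
  then show "finite ?Q" using card_KC_le(1) inj_on_finite by blast
  show "card ?Q \<le> 2 ^ (n + 1)"
    using card_inj_on_le[OF * card_KC_le(1)] card_KC_le(2)[of M A n] by linarith
qed

text \<open>An element of \<open>W r n\<close> is coded by an index of exactly \<open>l r n\<close>
  bits behind self-delimiting copies of \<open>r\<close> and \<open>n\<close>. The header determines
  the length of the index, which makes the codes prefix-free over all \<open>r\<close> and
  \<open>n\<close> together.\<close>

lemma KC_oracle_table:
  assumes "universal_prefix_machine U"
  shows "\<exists>c::nat. \<forall>W l. (\<forall>r n. finite (W r n) \<and> card (W r n) \<le> 2 ^ l r n) \<longrightarrow>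
     (\<exists>B. \<forall>A r n. \<forall>\<sigma>\<in>W r n. KC U (A \<squnion>\<^sub>T B) \<sigma> \<le>
        enat (2 * length (binary r) + 2 * length (binary n) + l r n + c))"
proof -
  obtain c :: nat where c: "\<And>(P :: bool list set) g. \<forall>p\<in>P. \<forall>p'\<in>P. prefix p p' \<longrightarrow> p = p' \<Longrightarrow>
       \<exists>B. \<forall>A. \<forall>p\<in>P. KC U (A \<squnion>\<^sub>T B) (g p) \<le> enat (length p + c)"
    using KC_oracle_code[OF assms] by metis
  show ?thesis
  \<comment> \<open>The extra 2 pays for the terminating bits of the two delimited numbers.\<close>
  proof (intro exI[of _ "c + 2"] allI impI)
    fix W :: "nat \<Rightarrow> nat \<Rightarrow> bool list set" and l :: "nat \<Rightarrow> nat \<Rightarrow> nat"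
    assume W: "\<forall>r n. finite (W r n) \<and> card (W r n) \<le> 2 ^ l r n"
    define S where "S = (\<lambda>r n. {w :: bool list. length w = l r n})"
    have cardS: "card (S r n) = 2 ^ l r n" "finite (S r n)" for r n
      using card_lists_length_eq[of "UNIV :: bool set" "l r n"] finite_lists_length_eq[of "UNIV :: bool set" "l r n"]
      by (auto simp: S_def)
    have "\<exists>h. W r n \<subseteq> h ` S r n" for r n
    proof -
      obtain f where f: "f ` W r n \<subseteq> S r n" "inj_on f (W r n)"
        using card_le_inj[of "W r n" "S r n"] W cardS[of r n] by metis
      then have "W r n \<subseteq> inv_into (W r n) f ` S r n" by (force simp: image_iff)
      then show ?thesis by blast
    qed
    then obtain h where h: "\<And>r n. W r n \<subseteq> h r n ` S r n" by metis
    define hdr where "hdr = (\<lambda>r n. delimited (binary r) @ delimited (binary n))"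
    have hdr: "hdr r n @ v = hdr r' n' @ v' \<longleftrightarrow> r = r' \<and> n = n' \<and> v = v'" for r n v r' n' v'
      by (auto simp: hdr_def delimited_append_inject binary_inject)
    define P where "P = {hdr r n @ w | r n w. w \<in> S r n}"
    define g where "g = (\<lambda>p. SOME \<sigma>. \<exists>r n w. p = hdr r n @ w \<and> \<sigma> = h r n w)"
    have g: "g (hdr r n @ w) = h r n w" for r n w
      unfolding g_def by (rule some_equality) (auto simp: hdr)
    have pf: "p = p'" if pp: "p \<in> P" "p' \<in> P" "prefix p p'" for p p'
    proof -
      obtain r n w where p: "p = hdr r n @ w" "w \<in> S r n" using pp(1) unfolding P_def by blast
      obtain r' n' w' where p': "p' = hdr r' n' @ w'" "w' \<in> S r' n'" using pp(2) unfolding P_def by blast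
      obtain u where "hdr r' n' @ w' = hdr r n @ (w @ u)" using pp(3) unfolding p p' by (auto simp: prefix_def)
      then have "r' = r" "n' = n" "w' = w @ u" unfolding hdr by auto
      then show ?thesis using p p' by (auto simp: S_def)
    qed
    obtain B where B: "\<And>A p. p \<in> P \<Longrightarrow> KC U (A \<squnion>\<^sub>T B) (g p) \<le> enat (length p + c)"
      using c[of P g] pf by metis
    have "KC U (A \<squnion>\<^sub>T B) \<sigma> \<le> enat (2 * length (binary r) + 2 * length (binary n) + l r n + (c + 2))"
      if \<sigma>: "\<sigma> \<in> W r n" for A r n \<sigma>
    proof -
      obtain w where w: "w \<in> S r n" "\<sigma> = h r n w" using h[of r n] \<sigma> by blast
      have "KC U (A \<squnion>\<^sub>T B) (g (hdr r n @ w)) \<le> enat (length (hdr r n @ w) + c)"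
        by (rule B) (use w P_def in blast)
      then have "KC U (A \<squnion>\<^sub>T B) \<sigma> \<le> enat (length (hdr r n @ w) + c)" unfolding g w(2) .
      then show ?thesis using w(1) by (simp add: hdr_def length_delimited S_def algebra_simps)
    qed
    then show "\<exists>B. \<forall>A r n. \<forall>\<sigma>\<in>W r n. KC U (A \<squnion>\<^sub>T B) \<sigma> \<le>
        enat (2 * length (binary r) + 2 * length (binary n) + l r n + (c + 2))" by blast
  qed
qed

text \<open>For \<open>n \<le> 4 * r\<close> the header has O(log r) bits. Together with the
  rounding of the logarithm and the constant it is absorbed by
  \<open>\<epsilon> * real r\<close>.\<close>

lemma KC_oracle_log_card:
  fixes W :: "nat \<Rightarrow> nat \<Rightarrow> bool list set"
  assumes U: "universal_prefix_machine U" and W: "\<And>r n. finite (W r n)" and \<epsilon>: "0 < \<epsilon>"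
  obtains B where "\<And>A. \<forall>\<^sub>F r in sequentially. \<forall>n\<le>4 * r. \<forall>\<sigma>\<in>W r n. \<exists>k.
    KC U (A \<squnion>\<^sub>T B) \<sigma> \<le> enat k \<and> real k \<le> log 2 (real (card (W r n))) + \<epsilon> * real r"
proof -
  define l where "l = (\<lambda>r n. nat \<lceil>log 2 (real (card (W r n)))\<rceil>)"
  have l: "card (W r n) \<le> 2 ^ l r n" for r n
  proof (cases "card (W r n) = 0")
    case False
    have "log 2 (real (card (W r n))) \<le> real (l r n)" unfolding l_def by linarith
    then have "real (card (W r n)) \<le> 2 powr real (l r n)" using False by (subst (asm) log_le_iff) auto
    then have "real (card (W r n)) \<le> real (2 ^ l r n)" by (simp add: powr_realpow)
    then show ?thesis unfolding of_nat_le_iff .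
  qed simp
  obtain c :: nat where "\<forall>W l. (\<forall>r n. finite (W r n) \<and> card (W r n) \<le> 2 ^ l r n) \<longrightarrow>
     (\<exists>B. \<forall>A r n. \<forall>\<sigma>\<in>W r n. KC U (A \<squnion>\<^sub>T B) \<sigma> \<le>
        enat (2 * length (binary r) + 2 * length (binary n) + l r n + c))"
    using KC_oracle_table[OF U] by (elim exE)
  then obtain B where B: "\<And>A r n \<sigma>. \<sigma> \<in> W r n \<Longrightarrow> KC U (A \<squnion>\<^sub>T B) \<sigma> \<le>
        enat (2 * length (binary r) + 2 * length (binary n) + l r n + c)"
    using W l by metis
  \<comment> \<open>Both \<open>r\<close> and \<open>n\<close> are at most \<open>4 * r\<close>, and
    each enters with twice its binary length; the summand 1 is for the rounding in
    \<open>l\<close>.\<close>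
  have "\<forall>\<^sub>F r in sequentially. 4 * (log 2 (4 * real r + 1) + 1) + 1 + real c \<le> \<epsilon> * real r"
    using \<epsilon> by real_asymp
  then have "\<forall>\<^sub>F r in sequentially. \<forall>n\<le>4 * r. \<forall>\<sigma>\<in>W r n. \<exists>k.
    KC U (A \<squnion>\<^sub>T B) \<sigma> \<le> enat k \<and> real k \<le> log 2 (real (card (W r n))) + \<epsilon> * real r" for A
  proof (rule eventually_mono, intro allI impI ballI)
    fix r n \<sigma> assume *: "4 * (log 2 (4 * real r + 1) + 1) + 1 + real c \<le> \<epsilon> * real r"
      and n: "n \<le> 4 * r" and \<sigma>: "\<sigma> \<in> W r n"
    let ?k = "2 * length (binary r) + 2 * length (binary n) + l r n + c"
    have mono: "log 2 (real r + 1) \<le> log 2 (4 * real r + 1)" "log 2 (real n + 1) \<le> log 2 (4 * real r + 1)"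
      using n by (auto simp: of_nat_le_iff[symmetric, where 'a = real])
    have "card (W r n) > 0" using \<sigma> W by (auto simp: card_gt_0_iff)
    then have "log 2 (real (card (W r n))) \<ge> 0" by simp
    then have "real (l r n) \<le> log 2 (real (card (W r n))) + 1" unfolding l_def by linarith
    moreover have "real (2 * length (binary r) + 2 * length (binary n)) \<le> 4 * (log 2 (4 * real r + 1) + 1)"
      using length_binary_le_log[of r] length_binary_le_log[of n] mono
      unfolding of_nat_add of_nat_mult of_nat_numeral by argo
    ultimately have "real ?k \<le> log 2 (real (card (W r n))) + \<epsilon> * real r"
      using * by simp
    then show "\<exists>k. KC U (A \<squnion>\<^sub>T B) \<sigma> \<le> enat k \<and> real k \<le> log 2 (real (card (W r n))) + \<epsilon> * real r"
      using B[OF \<sigma>] by blast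
  qed
  then show thesis by (rule that)
qed

section \<open>Grid points in strips\<close>

definition rat_point :: "rat ^ 'n \<Rightarrow> real ^ 'n" where
  "rat_point q = (\<chi> i. of_rat (q $ i))"

text \<open>With mesh 2^-(r+1) the rounding errors of the two coordinates add up to less than 2^-r.
  The rational version is the one that \<open>encode_vec\<close> can be applied to.\<close>

definition grid_rat :: "nat \<Rightarrow> int \<times> int \<Rightarrow> rat ^ 2" where
  "grid_rat r z = (\<chi> k. of_int (if k = 1 then fst z else snd z) / 2 ^ (r + 1))"

definition grid_point :: "nat \<Rightarrow> int \<times> int \<Rightarrow> real ^ 2" where
  "grid_point r z = (\<chi> k. of_int (if k = 1 then fst z else snd z) / 2 ^ (r + 1))"

lemma rat_point_grid: "rat_point (grid_rat r z) = grid_point r z"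
  by (simp add: rat_point_def grid_rat_def grid_point_def vec_eq_iff of_rat_divide of_rat_power of_rat_mult)

lemma grid_point_nth [simp]:
  "grid_point r z $ 1 = real_of_int (fst z) / 2 ^ (r + 1)"
  "grid_point r z $ 2 = real_of_int (snd z) / 2 ^ (r + 1)"
  by (auto simp: grid_point_def)

lemma norm_le_2: "norm (x :: real ^ 2) \<le> \<bar>x $ 1\<bar> + \<bar>x $ 2\<bar>"
  using norm_le_l1_cart[of x] by (simp add: UNIV_2)

text \<open>The box grows with \<open>r\<close>, so that every fixed point is eventually inside; the
  margin from \<open>r\<close> to \<open>r + 1\<close> allows for rounding.\<close>

lemma grid_point_approx:
  fixes x :: "real ^ 2"
  assumes "norm x \<le> real r"
  obtains z where "norm (grid_point r z - x) < 1 / 2 ^ r"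
    "\<bar>fst z\<bar> \<le> int (r + 1) * 2 ^ (r + 1)" "\<bar>snd z\<bar> \<le> int (r + 1) * 2 ^ (r + 1)"
proof -
  let ?c = "(2::real) ^ (r + 1)"
  have c: "?c > 0" "?c \<ge> 1" by (simp, rule one_le_power, simp)
  define f where "f = (\<lambda>t. \<lfloor>t * ?c\<rfloor>)"
  have approx: "\<bar>real_of_int (f t) / ?c - t\<bar> < 1 / ?c" for t
  proof -
    have "\<bar>real_of_int (f t) - t * ?c\<bar> < 1" unfolding f_def by linarith
    then have "\<bar>(real_of_int (f t) - t * ?c) / ?c\<bar> < 1 / ?c"
      using c(1) unfolding abs_divide by (simp add: divide_strict_right_mono)
    moreover have "(real_of_int (f t) - t * ?c) / ?c = real_of_int (f t) / ?c - t"
      using c(1) by (simp add: diff_divide_distrib)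
    ultimately show ?thesis by metis
  qed
  have bound: "\<bar>f t\<bar> \<le> int (r + 1) * 2 ^ (r + 1)" if t: "\<bar>t\<bar> \<le> real r" for t
  proof -
    have "\<bar>t * ?c\<bar> \<le> real r * ?c" using t c by (simp add: abs_mult)
    then have "\<bar>real_of_int (f t)\<bar> \<le> real r * ?c + 1" unfolding f_def by linarith
    also have "\<dots> \<le> real r * ?c + ?c" using c by simp
    also have "\<dots> = real_of_int (int (r + 1) * 2 ^ (r + 1))" by (simp add: algebra_simps)
    finally show ?thesis by linarith
  qed
  define z where "z = (f (x $ 1), f (x $ 2))"
  have "norm (grid_point r z - x) \<le> \<bar>(grid_point r z - x) $ 1\<bar> + \<bar>(grid_point r z - x) $ 2\<bar>"
    by (rule norm_le_2)
  also have "\<dots> < 1 / ?c + 1 / ?c"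
    using approx[of "x $ 1"] approx[of "x $ 2"] by (simp add: z_def)
  also have "\<dots> = 1 / 2 ^ r" by simp
  finally have "norm (grid_point r z - x) < 1 / 2 ^ r" .
  moreover have "\<bar>x $ k\<bar> \<le> real r" for k
    using component_le_norm_cart[of x k] assms by linarith
  ultimately show thesis using bound by (intro that[of z]) (auto simp: z_def)
qed

section \<open>Counting grid points\<close>

lemma card_int_interval:
  fixes a L :: real
  assumes "0 \<le> L"
  shows "finite {i :: int. \<bar>of_int i - a\<bar> \<le> L}" "real (card {i :: int. \<bar>of_int i - a\<bar> \<le> L}) \<le> 2 * L + 1"
proof -
  have eq: "{i :: int. \<bar>of_int i - a\<bar> \<le> L} = {\<lceil>a - L\<rceil>..\<lfloor>a + L\<rfloor>}"
    by (auto simp: ceiling_le_iff le_floor_iff)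
  then show "finite {i :: int. \<bar>of_int i - a\<bar> \<le> L}" by simp
  show "real (card {i :: int. \<bar>of_int i - a\<bar> \<le> L}) \<le> 2 * L + 1"
    unfolding eq using assms by simp linarith
qed

lemma card_int_box:
  fixes a b L :: real
  assumes "0 \<le> L"
  shows "finite {z :: int \<times> int. \<bar>of_int (fst z) - a\<bar> \<le> L \<and> \<bar>of_int (snd z) - b\<bar> \<le> L}"
    "real (card {z :: int \<times> int. \<bar>of_int (fst z) - a\<bar> \<le> L \<and> \<bar>of_int (snd z) - b\<bar> \<le> L}) \<le> (2 * L + 1)\<^sup>2"
proof -
  let ?I = "\<lambda>a. {i :: int. \<bar>of_int i - a\<bar> \<le> L}"
  have eq: "{z :: int \<times> int. \<bar>of_int (fst z) - a\<bar> \<le> L \<and> \<bar>of_int (snd z) - b\<bar> \<le> L} = ?I a \<times> ?I b"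
    by auto
  show "finite {z :: int \<times> int. \<bar>of_int (fst z) - a\<bar> \<le> L \<and> \<bar>of_int (snd z) - b\<bar> \<le> L}"
    unfolding eq using card_int_interval(1)[OF assms] by blast
  show "real (card {z :: int \<times> int. \<bar>of_int (fst z) - a\<bar> \<le> L \<and> \<bar>of_int (snd z) - b\<bar> \<le> L}) \<le> (2 * L + 1)\<^sup>2"
    unfolding eq card_cartesian_product of_nat_mult power2_eq_square
    by (intro mult_mono card_int_interval(2) assms) (use assms in auto)
qed

lemma card_UN_le_mult:
  assumes "finite I" "\<And>i. i \<in> I \<Longrightarrow> real (card (A i)) \<le> c"
  shows "real (card (\<Union>i\<in>I. A i)) \<le> real (card I) * c"
proof -
  have "real (card (\<Union>i\<in>I. A i)) \<le> (\<Sum>i\<in>I. real (card (A i)))"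
    using card_UN_le[OF assms(1), of A] by (metis of_nat_le_iff of_nat_sum)
  also have "\<dots> \<le> (\<Sum>i\<in>I. c)" by (intro sum_mono assms)
  finally show ?thesis by simp
qed

text \<open>
  Since \<open>n\<close> will be the complexity of a point truncated at \<open>4 * r\<close>, there is no complexity
  constraint from that value on.
\<close>

definition simple_grid :: "oracle_machine \<Rightarrow> nat set \<Rightarrow> nat \<Rightarrow> nat \<Rightarrow> (int \<times> int) set" where
  "simple_grid U A r n = {z. \<bar>fst z\<bar> \<le> int (r + 1) * 2 ^ (r + 1) \<and> \<bar>snd z\<bar> \<le> int (r + 1) * 2 ^ (r + 1) \<and>
     (n < 4 * r \<longrightarrow> (\<exists>q. KC U A (encode_vec q) \<le> enat n \<and> norm (rat_point q - grid_point r z) \<le> 2 / 2 ^ r))}"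

text \<open>By \<open>r + 1 \<le> 2 ^ r\<close>, each coordinate takes at most 5 * 4^r values in the
  box. The resulting 2^(4 r) is the origin of the cap \<open>4 * r\<close> on
  \<open>n\<close>.\<close>

lemma finite_simple_grid: "finite (simple_grid U A r n)"
  and card_simple_grid_box: "real (card (simple_grid U A r n)) \<le> 25 * 2 ^ (4 * r)"
proof -
  let ?B = "int (r + 1) * 2 ^ (r + 1)"
  let ?S = "{z :: int \<times> int. \<bar>of_int (fst z) - 0\<bar> \<le> real_of_int ?B \<and> \<bar>of_int (snd z) - 0\<bar> \<le> real_of_int ?B}"
  have sub: "simple_grid U A r n \<subseteq> ?S"
  proof
    have conv: "\<bar>real_of_int i - 0\<bar> \<le> real_of_int ?B" if "\<bar>i\<bar> \<le> ?B" for i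
      using that by (metis diff_zero of_int_abs of_int_le_iff)
    fix z assume "z \<in> simple_grid U A r n"
    then show "z \<in> ?S" using conv[of "fst z"] conv[of "snd z"] unfolding simple_grid_def by blast
  qed
  have B: "0 \<le> real_of_int ?B" by simp
  show fin: "finite (simple_grid U A r n)" by (rule finite_subset[OF sub card_int_box(1)[OF B]])
  have "real (card (simple_grid U A r n)) \<le> real (card ?S)"
    using card_mono[OF card_int_box(1)[OF B] sub] by simp
  also have "\<dots> \<le> (2 * real_of_int ?B + 1)\<^sup>2" by (rule card_int_box(2)[OF B])
  also have "\<dots> \<le> (5 * (2 ^ r * 2 ^ r))\<^sup>2"
  proof (rule power_mono)
    have "real (r + 1) \<le> 2 ^ r" by (metis Suc_eq_plus1 Suc_leI less_exp of_nat_le_iff of_nat_numeral of_nat_power)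
    then have "real_of_int ?B \<le> 2 * (2 ^ r * 2 ^ r)" by (simp add: mult_right_mono)
    moreover have "(1::real) \<le> 2 ^ r * 2 ^ r" by (metis one_le_numeral one_le_power power_add)
    ultimately show "2 * real_of_int ?B + 1 \<le> 5 * (2 ^ r * 2 ^ r)" by linarith
  qed (use B in simp)
  also have "\<dots> = 25 * 2 ^ (4 * r)"
    by (simp add: power2_eq_square power_add[symmetric] mult.assoc)
  finally show "real (card (simple_grid U A r n)) \<le> 25 * 2 ^ (4 * r)" .
qed

text \<open>At most 2^(n+1) rational vectors have complexity at most \<open>n\<close>. The distance
  2 / 2^r is four mesh widths, so each of them is near at most 9^2 = 81 grid points, and 2 * 81 =
  162. From the cap on, the size of the whole box is small enough.\<close>

lemma card_simple_grid: "real (card (simple_grid U A r n)) \<le> 162 * 2 ^ n"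
proof (cases "n < 4 * r")
  case False
  then have "(2::real) ^ (4 * r) \<le> 2 ^ n" by (intro power_increasing) auto
  then have "25 * 2 ^ (4 * r) \<le> 162 * (2::real) ^ n" by (intro mult_mono) auto
  then show ?thesis using card_simple_grid_box[of U A r n] by linarith
next
  case True
  let ?c = "(2::real) ^ (r + 1)"
  have c: "?c > 0" by simp
  define Q where "Q = {q :: rat ^ 2. KC U A (encode_vec q) \<le> enat n}"
  have Q: "finite Q" "card Q \<le> 2 ^ (n + 1)" unfolding Q_def by (rule card_KC_vec_le)+
  define N where "N = (\<lambda>q :: rat ^ 2. {z :: int \<times> int. \<bar>of_int (fst z) - rat_point q $ 1 * ?c\<bar> \<le> 4 \<and>
    \<bar>of_int (snd z) - rat_point q $ 2 * ?c\<bar> \<le> 4})"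
  have N: "finite (N q)" "real (card (N q)) \<le> 81" for q
    using card_int_box[of 4 "rat_point q $ 1 * ?c" "rat_point q $ 2 * ?c"] unfolding N_def by auto
  have "simple_grid U A r n \<subseteq> (\<Union>q\<in>Q. N q)"
  proof
    fix z assume "z \<in> simple_grid U A r n"
    then obtain q where q: "KC U A (encode_vec q) \<le> enat n" "norm (rat_point q - grid_point r z) \<le> 2 / 2 ^ r"
      using True unfolding simple_grid_def by blast
    have *: "\<bar>i - t * ?c\<bar> \<le> 4" if "\<bar>t - i / ?c\<bar> \<le> 2 / 2 ^ r" for t i :: real
    proof -
      have "t * ?c - i = (t - i / ?c) * ?c" using c by (simp add: left_diff_distrib)
      then have "\<bar>t * ?c - i\<bar> = \<bar>t - i / ?c\<bar> * ?c" using c by (simp only: abs_mult abs_of_pos)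
      also have "\<dots> \<le> 2 / 2 ^ r * ?c" using that c by (intro mult_right_mono) auto
      also have "\<dots> = 4" by simp
      finally show ?thesis by (simp only: abs_minus_commute)
    qed
    have "\<bar>(rat_point q - grid_point r z) $ k\<bar> \<le> 2 / 2 ^ r" for k
      using component_le_norm_cart[of "rat_point q - grid_point r z" k] q(2) by linarith
    from *[of "rat_point q $ 1" "of_int (fst z)"] *[of "rat_point q $ 2" "of_int (snd z)"] this[of 1] this[of 2]
    have "z \<in> N q" by (simp add: N_def)
    then show "z \<in> (\<Union>q\<in>Q. N q)" using q(1) unfolding Q_def by blast
  qed
  then have "card (simple_grid U A r n) \<le> card (\<Union>q\<in>Q. N q)"
    using Q(1) N(1) by (intro card_mono) auto
  also have "real (card (\<Union>q\<in>Q. N q)) \<le> real (card Q) * 81"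
    by (rule card_UN_le_mult[OF Q(1) N(2)])
  also have "\<dots> \<le> real (2 ^ (n + 1)) * 81" using Q(2) by (intro mult_right_mono of_nat_mono) auto
  finally show ?thesis by (simp add: mult.commute)
qed

text \<open>For unit vectors this is the sine of the angle between them. It is also the determinant
  of the linear system that locates a point from its projections in the directions \<open>e\<close>
  and \<open>g\<close>.\<close>

definition det2 :: "real ^ 2 \<Rightarrow> real ^ 2 \<Rightarrow> real" where
  "det2 e g = e $ 1 * g $ 2 - e $ 2 * g $ 1"

lemma unit_vector_2: "norm (e :: real ^ 2) = 1 \<Longrightarrow> (e $ 1)\<^sup>2 + (e $ 2)\<^sup>2 = 1"
  by (simp add: norm_eq_1 inner_vec_def UNIV_2 power2_eq_square)

lemma unit_component_le: "norm (e :: real ^ 'n) = 1 \<Longrightarrow> \<bar>e $ k\<bar> \<le> 1"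
  using component_le_norm_cart[of e k] by simp

text \<open>With \<open>c\<close> the inner product, c^2 + det^2 = 1, so 1 - |c| \<le> 1 - c^2 \<le>
  \<theta>^2, while the smaller of the two squared distances is 2 - 2 |c|. A small determinant does
  not tell \<open>g\<close> from \<open>- g\<close>, hence the two alternatives.\<close>

lemma almost_parallel:
  assumes "norm e = 1" "norm g = 1" "\<bar>det2 g e\<bar> < \<theta>"
  shows "norm (g - e) \<le> 2 * \<theta> \<or> norm (- g - e) \<le> 2 * \<theta>"
proof -
  define a b where "a = (norm (g - e))\<^sup>2" and "b = (norm (- g - e))\<^sup>2"
  have sq: "(norm x)\<^sup>2 = (x $ 1)\<^sup>2 + (x $ 2)\<^sup>2" for x :: "real ^ 2"
    unfolding power2_norm_eq_inner by (simp add: inner_vec_def UNIV_2 power2_eq_square)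
  have e: "(e $ 1)\<^sup>2 + (e $ 2)\<^sup>2 = 1" and g: "(g $ 1)\<^sup>2 + (g $ 2)\<^sup>2 = 1"
    using assms unit_vector_2 by auto
  define c where "c = g $ 1 * e $ 1 + g $ 2 * e $ 2"
  have a: "a = 2 - 2 * c" unfolding a_def sq c_def using e g by (simp add: power2_eq_square algebra_simps)
  have b: "b = 2 + 2 * c" unfolding b_def sq c_def using e g by (simp add: power2_eq_square algebra_simps)
  have "c\<^sup>2 + (det2 g e)\<^sup>2 = ((e $ 1)\<^sup>2 + (e $ 2)\<^sup>2) * ((g $ 1)\<^sup>2 + (g $ 2)\<^sup>2)"
    unfolding c_def det2_def by (simp add: power2_eq_square algebra_simps)
  then have cd: "c\<^sup>2 + (det2 g e)\<^sup>2 = 1" using e g by simp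
  have "(det2 g e)\<^sup>2 \<le> \<theta>\<^sup>2" using assms(3) by (metis abs_ge_zero less_le power2_abs power_mono)
  then have d: "1 - c\<^sup>2 \<le> \<theta>\<^sup>2" using cd by linarith
  have "\<theta> > 0" using assms(3) by linarith
  have "c\<^sup>2 \<le> 1" using cd by (smt (verit) zero_le_power2)
  then have c1: "\<bar>c\<bar> \<le> 1" by (simp add: abs_square_le_1)
  show ?thesis
  proof (cases "c \<ge> 0")
    case True
    have "(1 - c) * 1 \<le> (1 - c) * (1 + c)" using True c1 by (intro mult_left_mono) auto
    then have "a \<le> 2 * \<theta>\<^sup>2" using d unfolding a by (simp add: power2_eq_square algebra_simps)
    also have "\<dots> \<le> (2 * \<theta>)\<^sup>2" by (simp add: power_mult_distrib)
    finally have "a \<le> (2 * \<theta>)\<^sup>2" .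
    then show ?thesis unfolding a_def using \<open>\<theta> > 0\<close> by (meson less_imp_le mult_nonneg_nonneg power2_le_imp_le zero_le_numeral)
  next
    case False
    have "(1 + c) * 1 \<le> (1 + c) * (1 - c)" using False c1 by (intro mult_left_mono) auto
    then have "b \<le> 2 * \<theta>\<^sup>2" using d unfolding b by (simp add: power2_eq_square algebra_simps)
    also have "\<dots> \<le> (2 * \<theta>)\<^sup>2" by (simp add: power_mult_distrib)
    finally have "b \<le> (2 * \<theta>)\<^sup>2" .
    then show ?thesis unfolding b_def using \<open>\<theta> > 0\<close> by (meson less_imp_le mult_nonneg_nonneg power2_le_imp_le zero_le_numeral)
  qed
qed

text \<open>The half-width 2 / 2^r leaves room for two errors of 2^-r: rounding a point to the grid,
  and approximating its projection by an element of \<open>Y\<close>.\<close>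

definition grid_strips :: "nat \<Rightarrow> real ^ 2 \<Rightarrow> real set \<Rightarrow> (int \<times> int) set" where
  "grid_strips r e Y = {z. \<exists>y\<in>Y. \<bar>grid_point r z \<bullet> e - y\<bar> \<le> 2 / 2 ^ r}"

text \<open>Two transversal strips meet in a parallelogram of size comparable to the strip width
  divided by the sine of the angle. In grid units each coordinate is confined to an interval of
  radius 8 / \<theta>, and (16 / \<theta> + 1)^2 \<le> (17 / \<theta>)^2 because \<theta> \<le> 1.
  There are at most \<open>m\<^sup>2\<close> pairs of strips.\<close>

lemma card_grid_strips_Int:
  assumes "norm e = 1" "norm g = 1" "0 < \<theta>" "\<theta> \<le> 1" "\<theta> \<le> \<bar>det2 e g\<bar>" "finite Y" "finite Y'"
    "real (card Y) \<le> m" "real (card Y') \<le> m"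
  shows "finite (grid_strips r e Y \<inter> grid_strips r g Y')"
    and "real (card (grid_strips r e Y \<inter> grid_strips r g Y')) \<le> m\<^sup>2 * (17 / \<theta>)\<^sup>2"
proof -
  let ?c = "(2::real) ^ (r + 1)" and ?D = "det2 e g"
  have c: "?c > 0" by simp
  have D: "?D \<noteq> 0" using assms by auto
  \<comment> \<open>Cramer's rule: \<open>a\<close> and \<open>b\<close> are the coordinates, in
    grid units, of the point with projections \<open>y\<close> and \<open>y'\<close>.\<close>
  define a where "a = (\<lambda>(y, y'). (y * g $ 2 - y' * e $ 2) / ?D * ?c)"
  define b where "b = (\<lambda>(y, y'). (y' * e $ 1 - y * g $ 1) / ?D * ?c)"
  define N where "N = (\<lambda>p. {z :: int \<times> int. \<bar>of_int (fst z) - a p\<bar> \<le> 8 / \<theta> \<and> \<bar>of_int (snd z) - b p\<bar> \<le> 8 / \<theta>})"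
  \<comment> \<open>One estimate for both coordinates: \<open>u\<close> and \<open>v\<close> are
    deviations from the centres of the strips, \<open>s\<close> and \<open>s'\<close> are components
    of the unit vectors.\<close>
  have key: "\<bar>t * ?c - w / ?D * ?c\<bar> \<le> 8 / \<theta>"
    if "t * ?D - w = u * s - v * s'" "\<bar>u\<bar> \<le> 2 / 2 ^ r" "\<bar>v\<bar> \<le> 2 / 2 ^ r" "\<bar>s\<bar> \<le> 1" "\<bar>s'\<bar> \<le> 1" for t w u v s s' :: real
  proof -
    have "\<bar>u * s\<bar> \<le> 2 / 2 ^ r * 1" "\<bar>v * s'\<bar> \<le> 2 / 2 ^ r * 1" unfolding abs_mult using that
      by (intro mult_mono; simp)+
    then have "\<bar>t * ?D - w\<bar> \<le> 4 / 2 ^ r" unfolding that(1) by linarith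
    then have "\<bar>t * ?D - w\<bar> * ?c / \<bar>?D\<bar> \<le> 4 / 2 ^ r * ?c / \<theta>"
      using assms c by (intro frac_le mult_right_mono) auto
    moreover have "t * ?c - w / ?D * ?c = (t * ?D - w) * ?c / ?D" using D by (simp add: field_simps)
    then have "\<bar>t * ?c - w / ?D * ?c\<bar> = \<bar>t * ?D - w\<bar> * ?c / \<bar>?D\<bar>" using c by (simp add: abs_mult abs_divide)
    ultimately show ?thesis by simp
  qed
  have sub: "grid_strips r e Y \<inter> grid_strips r g Y' \<subseteq> (\<Union>p\<in>Y \<times> Y'. N p)"
  proof
    fix z assume "z \<in> grid_strips r e Y \<inter> grid_strips r g Y'"
    then obtain y y' where y: "y \<in> Y" "y' \<in> Y'" "\<bar>grid_point r z \<bullet> e - y\<bar> \<le> 2 / 2 ^ r" "\<bar>grid_point r z \<bullet> g - y'\<bar> \<le> 2 / 2 ^ r"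
      unfolding grid_strips_def by blast
    let ?p = "grid_point r z"
    have e: "?p \<bullet> e = ?p $ 1 * e $ 1 + ?p $ 2 * e $ 2" and g: "?p \<bullet> g = ?p $ 1 * g $ 1 + ?p $ 2 * g $ 2"
      by (simp_all add: inner_vec_def UNIV_2 del: grid_point_nth)
    have z: "?p $ 1 * ?c = of_int (fst z)" "?p $ 2 * ?c = of_int (snd z)" by auto
    have "\<bar>?p $ 1 * ?c - a (y, y')\<bar> \<le> 8 / \<theta>" unfolding a_def prod.case
      by (rule key[of _ _ "?p \<bullet> e - y" "g $ 2" "?p \<bullet> g - y'" "e $ 2"])
        (use y unit_component_le assms in \<open>auto simp: e g det2_def algebra_simps simp del: grid_point_nth\<close>)
    moreover have "\<bar>?p $ 2 * ?c - b (y, y')\<bar> \<le> 8 / \<theta>" unfolding b_def prod.case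
      by (rule key[of _ _ "?p \<bullet> g - y'" "e $ 1" "?p \<bullet> e - y" "g $ 1"])
        (use y unit_component_le assms in \<open>auto simp: e g det2_def algebra_simps simp del: grid_point_nth\<close>)
    ultimately have "z \<in> N (y, y')" unfolding N_def z by simp
    then show "z \<in> (\<Union>p\<in>Y \<times> Y'. N p)" using y by blast
  qed
  have N: "finite (N p)" "real (card (N p)) \<le> (17 / \<theta>)\<^sup>2" for p
  proof -
    have L: "0 \<le> 8 / \<theta>" using assms by simp
    show "finite (N p)" unfolding N_def by (rule card_int_box(1)[OF L])
    have "real (card (N p)) \<le> (2 * (8 / \<theta>) + 1)\<^sup>2" unfolding N_def by (rule card_int_box(2)[OF L])
    also have "\<dots> \<le> (17 / \<theta>)\<^sup>2" using assms by (intro power_mono) (auto simp: field_simps)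
    finally show "real (card (N p)) \<le> (17 / \<theta>)\<^sup>2" .
  qed
  have fin: "finite (\<Union>p\<in>Y \<times> Y'. N p)" using assms N by blast
  then show "finite (grid_strips r e Y \<inter> grid_strips r g Y')" by (rule finite_subset[OF sub])
  have "card (grid_strips r e Y \<inter> grid_strips r g Y') \<le> card (\<Union>p\<in>Y \<times> Y'. N p)"
    using fin sub by (rule card_mono)
  also have "real (card (\<Union>p\<in>Y \<times> Y'. N p)) \<le> real (card (Y \<times> Y')) * (17 / \<theta>)\<^sup>2"
    using assms N by (intro card_UN_le_mult) auto
  also have "\<dots> \<le> m\<^sup>2 * (17 / \<theta>)\<^sup>2"
    unfolding card_cartesian_product of_nat_mult power2_eq_square[of m]
    using assms(8) assms(8,9) by (intro mult_right_mono mult_mono) auto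
  finally show "real (card (grid_strips r e Y \<inter> grid_strips r g Y')) \<le> m\<^sup>2 * (17 / \<theta>)\<^sup>2" by simp
qed

text \<open>A new set adds at least L - |G| c elements to the union. The square, in place of the
  number of pairs, keeps the induction simple.\<close>

lemma card_UN_ge_Bonferroni:
  assumes "finite G" "\<And>i. i \<in> G \<Longrightarrow> finite (A i)" "\<And>i. i \<in> G \<Longrightarrow> L \<le> real (card (A i))"
    "\<And>i j. i \<in> G \<Longrightarrow> j \<in> G \<Longrightarrow> i \<noteq> j \<Longrightarrow> real (card (A i \<inter> A j)) \<le> c" "0 \<le> c"
  shows "real (card G) * L \<le> real (card (\<Union>i\<in>G. A i)) + (real (card G))\<^sup>2 * c"
  using assms(1-4)
proof (induction G rule: finite_induct)
  case (insert j G)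
  let ?U = "\<Union>i\<in>G. A i"
  have "real (card (A j \<inter> ?U)) = real (card (\<Union>i\<in>G. A j \<inter> A i))" by (simp only: Int_UN_distrib)
  also have "\<dots> \<le> real (card G) * c"
    using insert.hyps insert.prems by (intro card_UN_le_mult) auto
  finally have 1: "real (card (A j \<inter> ?U)) \<le> real (card G) * c" .
  have "card (A j) + card ?U = card (A j \<union> ?U) + card (A j \<inter> ?U)"
    using insert by (intro card_Un_Int) auto
  then have 2: "real (card (A j)) + real (card ?U) = real (card (\<Union>i\<in>insert j G. A i)) + real (card (A j \<inter> ?U))"
    by (metis UN_insert of_nat_add)
  have 3: "real (card G) * L \<le> real (card ?U) + (real (card G))\<^sup>2 * c"
    using insert by auto
  have 4: "L \<le> real (card (A j))" using insert by auto
  have "(real (card G))\<^sup>2 * c + real (card G) * c \<le> (real (card G) + 1)\<^sup>2 * c"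
    using assms(5) unfolding distrib_right[symmetric]
    by (intro mult_right_mono) (auto simp: power2_eq_square algebra_simps)
  then show ?case using insert.hyps 1 2 3 4 by (simp add: algebra_simps)
qed simp

text \<open>\<open>P\<close> stands for being far apart. A separated set of largest cardinality,
  which exists by the bound \<open>m\<close>, cannot be enlarged, so every point of \<open>F\<close>
  belongs to it or is close to it.\<close>

lemma finite_net_exists:
  assumes "\<And>G. finite G \<Longrightarrow> G \<subseteq> F \<Longrightarrow> (\<forall>x\<in>G. \<forall>y\<in>G. x \<noteq> y \<longrightarrow> P x y) \<Longrightarrow> card G \<le> m"
    and "\<And>x y. P x y \<Longrightarrow> P y x"
  obtains G where "finite G" "G \<subseteq> F" "card G \<le> m" "\<And>x. x \<in> F \<Longrightarrow> x \<in> G \<or> (\<exists>g\<in>G. \<not> P g x)"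
proof -
  define S where "S = (\<lambda>G. finite G \<and> G \<subseteq> F \<and> (\<forall>x\<in>G. \<forall>y\<in>G. x \<noteq> y \<longrightarrow> P x y))"
  have "S {}" by (simp add: S_def)
  moreover have "\<forall>G. S G \<longrightarrow> card G < Suc m" using assms(1) by (auto simp: S_def less_Suc_eq_le)
  ultimately obtain G where G: "S G" "\<And>G'. S G' \<Longrightarrow> card G' \<le> card G"
    using ex_has_greatest_nat[of S "{}" card "Suc m"] by (metis less_imp_le)
  show thesis
  proof (rule that[of G])
    show "finite G" "G \<subseteq> F" using G(1) by (auto simp: S_def)
    then show "card G \<le> m" using G(1) assms(1) by (auto simp: S_def)
    show "x \<in> G \<or> (\<exists>g\<in>G. \<not> P g x)" if "x \<in> F" for x
    proof (rule ccontr)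
      assume *: "\<not> (x \<in> G \<or> (\<exists>g\<in>G. \<not> P g x))"
      then have "S (insert x G)" using G(1) that assms(2) unfolding S_def by auto
      from G(2)[OF this] show False using * \<open>finite G\<close> by simp
    qed
  qed
qed

section \<open>Exceptional directions\<close>

lemma KC_prec_le:
  assumes "norm (rat_point q - x) < 1 / 2 ^ r"
  shows "KC_prec U A r x \<le> KC U A (encode_vec q)"
  unfolding KC_prec_def by (rule INF_lower) (use assms in \<open>simp add: rat_point_def\<close>)

lemma KC_prec_le_enatE:
  assumes "KC_prec U A r x \<le> enat n"
  obtains q where "norm (rat_point q - x) < 1 / 2 ^ r" "KC U A (encode_vec q) \<le> enat n"
proof -
  have "KC_prec U A r x < enat (Suc n)" using assms by (simp add: order_le_less_trans[of _ "enat n"])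
  then obtain q where "norm (rat_point q - x) < 1 / 2 ^ r" "KC U A (encode_vec q) < enat (Suc n)"
    unfolding KC_prec_def INF_less_iff rat_point_def by blast
  moreover have "k \<le> enat n" if "k < enat (Suc n)" for k using that by (cases k) auto
  ultimately show thesis using that by blast
qed

text \<open>The grid point next to \<open>x\<close> has an entry in the table \<open>B\<close>, so
  \<open>KC_prec U (A \<squnion>\<^sub>T B) r x\<close> is at most log |V r n| + \<epsilon> r.
  Optimality bounds the same quantity below by n - \<epsilon> r, and the dimension of
  \<open>x\<close> bounds it below by d r.\<close>

lemma optimal_oracle_heavy_strips:
  fixes E :: "(real ^ 2) set"
  assumes U: "universal_prefix_machine U" and opt: "optimal_hausdorff_oracle U A E"
    and d: "ereal d < hausdorff_dim E" and \<epsilon>: "0 < \<epsilon>" and e: "norm e = 1"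
    and Y: "\<And>x. x \<in> E \<Longrightarrow> \<exists>\<^sub>F r in sequentially. \<exists>y\<in>Y r. \<bar>x \<bullet> e - y\<bar> \<le> 1 / 2 ^ r"
  shows "\<exists>\<^sub>F r in sequentially. \<exists>n\<le>4 * r. 2 powr (max (real n) (d * real r) - 2 * \<epsilon> * real r) \<le>
     real (card (simple_grid U A r n \<inter> grid_strips r e (Y r)))"
proof -
  define V where "V = (\<lambda>r n. simple_grid U A r n \<inter> grid_strips r e (Y r))"
  define W where "W = (\<lambda>r n. (\<lambda>z. encode_vec (grid_rat r z)) ` V r n)"
  have finV: "finite (V r n)" for r n unfolding V_def using finite_simple_grid by blast
  then have "finite (W r n)" for r n unfolding W_def by blast
  then obtain B where B: "\<And>A. \<forall>\<^sub>F r in sequentially. \<forall>n\<le>4 * r. \<forall>\<sigma>\<in>W r n. \<exists>k.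
    KC U (A \<squnion>\<^sub>T B) \<sigma> \<le> enat k \<and> real k \<le> log 2 (real (card (W r n))) + \<epsilon> * real r"
    using KC_oracle_log_card[OF U _ \<epsilon>, of W] by blast
  \<comment> \<open>Optimality is applied with a possibly smaller \<open>\<delta>\<close>, so that
    the dimension of \<open>x\<close> still exceeds \<open>d\<close>.\<close>
  obtain \<delta> where \<delta>: "0 < \<delta>" "\<delta> \<le> \<epsilon>" "ereal d < hausdorff_dim E - ereal \<delta>"
  proof (cases "hausdorff_dim E")
    case (real D)
    then show thesis using d \<epsilon> by (intro that[of "min \<epsilon> ((D - d) / 2)"]) (auto simp: min_def field_simps)
  qed (use d \<epsilon> that[of \<epsilon>] in auto)
  obtain x where x: "x \<in> E" "point_dim U (A \<squnion>\<^sub>T B) x \<ge> hausdorff_dim E - ereal \<delta>"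
    and close: "\<forall>\<^sub>F r in sequentially. ereal_of_enat (KC_prec U (A \<squnion>\<^sub>T B) r x)
             \<ge> ereal_of_enat (KC_prec U A r x) - ereal (\<delta> * real r)"
    using opt \<delta>(1) unfolding optimal_hausdorff_oracle_def by blast
  have "ereal d < liminf (\<lambda>r. ereal_of_enat (KC_prec U (A \<squnion>\<^sub>T B) r x) / ereal (real r))"
    using \<delta>(3) x(2) unfolding point_dim_def by (rule less_le_trans)
  from less_LiminfD[OF this]
  have low: "\<forall>\<^sub>F r in sequentially. ereal d < ereal_of_enat (KC_prec U (A \<squnion>\<^sub>T B) r x) / ereal (real r)" .
  have big: "\<forall>\<^sub>F r in sequentially. norm x \<le> real r \<and> 0 < r"
    by (intro eventually_conj eventually_gt_at_top eventually_compose_filterlim[OF eventually_ge_at_top filterlim_real_sequentially])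
  have "\<exists>\<^sub>F r in sequentially. \<exists>n\<le>4 * r. 2 powr (max (real n) (d * real r) - 2 * \<epsilon> * real r) \<le> real (card (V r n))"
    using Y[OF x(1)]
  proof (rule frequently_rev_mp)
    show "\<forall>\<^sub>F r in sequentially. (\<exists>y\<in>Y r. \<bar>x \<bullet> e - y\<bar> \<le> 1 / 2 ^ r) \<longrightarrow>
      (\<exists>n\<le>4 * r. 2 powr (max (real n) (d * real r) - 2 * \<epsilon> * real r) \<le> real (card (V r n)))"
      using close low big B[of A]
    proof eventually_elim
      case (elim r)
      show ?case
      proof
        assume "\<exists>y\<in>Y r. \<bar>x \<bullet> e - y\<bar> \<le> 1 / 2 ^ r"
        then obtain y where y: "y \<in> Y r" "\<bar>x \<bullet> e - y\<bar> \<le> 1 / 2 ^ r" by blast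
        \<comment> \<open>The truncation makes \<open>n\<close> finite and at most
          \<open>4 * r\<close>, the range in which the table lookup is cheap.\<close>
        obtain n where n: "enat n = min (KC_prec U A r x) (enat (4 * r))"
          by (metis enat_ile min.cobounded2)
        then have n4: "n \<le> 4 * r" by (metis enat_ord_simps(1) min.cobounded2)
        have nK: "enat n \<le> KC_prec U A r x" using n by simp
        obtain z where z: "norm (grid_point r z - x) < 1 / 2 ^ r"
          "\<bar>fst z\<bar> \<le> int (r + 1) * 2 ^ (r + 1)" "\<bar>snd z\<bar> \<le> int (r + 1) * 2 ^ (r + 1)"
          using grid_point_approx[of x r] elim(3) by blast
        have zV: "z \<in> V r n"
        proof -
          have "\<exists>q. KC U A (encode_vec q) \<le> enat n \<and> norm (rat_point q - grid_point r z) \<le> 2 / 2 ^ r" if "n < 4 * r"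
          proof -
            have "KC_prec U A r x \<le> enat n" using n that by (auto simp: min_def split: if_splits)
            then obtain q where q: "norm (rat_point q - x) < 1 / 2 ^ r" "KC U A (encode_vec q) \<le> enat n"
              by (rule KC_prec_le_enatE)
            have "norm (rat_point q - grid_point r z) \<le> norm (rat_point q - x) + norm (grid_point r z - x)"
              by (metis norm_triangle_ineq4 diff_diff_eq2 diff_add_cancel add_diff_cancel_right' diff_add_eq)
            also have "\<dots> \<le> 2 / 2 ^ r" using q(1) z(1) by simp
            finally show ?thesis using q(2) by blast
          qed
          moreover have "\<bar>grid_point r z \<bullet> e - y\<bar> \<le> 2 / 2 ^ r"
          proof -
            have "\<bar>(grid_point r z - x) \<bullet> e\<bar> \<le> norm (grid_point r z - x)"
              using Cauchy_Schwarz_ineq2[of "grid_point r z - x" e] e by simp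
            then have "\<bar>grid_point r z \<bullet> e - x \<bullet> e\<bar> \<le> 1 / 2 ^ r" using z(1) by (simp add: inner_diff_left)
            then show ?thesis using y(2) by simp
          qed
          ultimately show ?thesis
            using z y(1) unfolding V_def simple_grid_def grid_strips_def by blast
        qed
        then have "encode_vec (grid_rat r z) \<in> W r n" unfolding W_def by blast
        then obtain k where k: "KC U (A \<squnion>\<^sub>T B) (encode_vec (grid_rat r z)) \<le> enat k"
          "real k \<le> log 2 (real (card (W r n))) + \<epsilon> * real r"
          using elim(4) n4 by blast
        have "KC_prec U (A \<squnion>\<^sub>T B) r x \<le> enat k"
          using KC_prec_le[of "grid_rat r z" x r U "A \<squnion>\<^sub>T B"] z(1) k(1) by (simp add: rat_point_grid)
        then obtain m where m: "KC_prec U (A \<squnion>\<^sub>T B) r x = enat m" "m \<le> k"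
          by (cases "KC_prec U (A \<squnion>\<^sub>T B) r x") auto
        have "card (W r n) \<le> card (V r n)" unfolding W_def by (rule card_image_le[OF finV])
        moreover have "card (W r n) > 0" "card (V r n) > 0"
          using zV finV by (auto simp: W_def card_gt_0_iff)
        ultimately have kV: "real k \<le> log 2 (real (card (V r n))) + \<epsilon> * real r"
          using k(2) by (smt (verit) log_mono of_nat_0_less_iff of_nat_mono)
        have r: "0 < real r" using elim(3) by simp
        have "d < real m / real r" using elim(2) r by (simp add: m)
        then have "d * real r < real m" using r by (simp add: pos_less_divide_eq)
        moreover have "real n - \<epsilon> * real r \<le> real m"
        proof -
          have "ereal (real n) - ereal (\<delta> * real r) \<le> ereal_of_enat (KC_prec U A r x) - ereal (\<delta> * real r)"
            using nK by (intro ereal_minus_mono) (auto simp flip: ereal_of_enat_simps(1))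
          also have "\<dots> \<le> ereal (real m)" using elim(1) by (simp add: m)
          finally have "real n - \<delta> * real r \<le> real m" by simp
          moreover have "\<delta> * real r \<le> \<epsilon> * real r" using \<delta>(2) by (intro mult_right_mono) auto
          ultimately show ?thesis by linarith
        qed
        moreover have "0 \<le> \<epsilon> * real r" using \<epsilon> by simp
        ultimately have "max (real n) (d * real r) - 2 * \<epsilon> * real r \<le> log 2 (real (card (V r n)))"
          using kV m(2) by (auto simp: max_def)
        then have "2 powr (max (real n) (d * real r) - 2 * \<epsilon> * real r) \<le> 2 powr log 2 (real (card (V r n)))"
          by simp
        also have "\<dots> = real (card (V r n))" using \<open>card (V r n) > 0\<close> by simp
        finally show "\<exists>n\<le>4 * r. 2 powr (max (real n) (d * real r) - 2 * \<epsilon> * real r) \<le> real (card (V r n))"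
          using n4 by blast
      qed
    qed
  qed
  then show ?thesis unfolding V_def .
qed

text \<open>\<open>Y\<close> is chosen separately for each direction at a single scale, so
  directions with unrelated families of strips can be counted together.\<close>

definition heavy_directions :: "oracle_machine \<Rightarrow> nat set \<Rightarrow> real \<Rightarrow> real \<Rightarrow> real \<Rightarrow> nat \<Rightarrow> nat \<Rightarrow> (real ^ 2) set" where
  "heavy_directions U A s d \<epsilon> r n = {e. norm e = 1 \<and> (\<exists>Y. finite Y \<and> real (card Y) \<le> 2 powr (s * real r) \<and>
     2 powr (max (real n) (d * real r) - 2 * \<epsilon> * real r) \<le> real (card (simple_grid U A r n \<inter> grid_strips r e Y)))}"

text \<open>The strips of \<open>m\<close> separated directions give \<open>m\<close> subsets of a
  set of at most 162 * 2^n points, each with at least \<open>L\<close> elements and with pairwise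
  intersections of at most \<open>c\<close>. The gap makes m c \<le> L / 2, and 2^n \<le> 2^(2
  \<epsilon> r) L, so the Bonferroni bound yields m \<le> 324 * 2^(2 \<epsilon> r), which is less
  than 2^(3 \<epsilon> r) for large \<open>r\<close>.\<close>

lemma card_separated_heavy_directions:
  assumes \<kappa>: "0 < \<kappa>" and \<epsilon>: "0 < \<epsilon>" and gap: "2 * s + 2 * \<kappa> + 5 * \<epsilon> < d"
  shows "\<forall>\<^sub>F r in sequentially. \<forall>n G. finite G \<longrightarrow> G \<subseteq> heavy_directions U A s d \<epsilon> r n \<longrightarrow>
    (\<forall>e\<in>G. \<forall>g\<in>G. e \<noteq> g \<longrightarrow> 2 powr (- (\<kappa> * real r)) \<le> \<bar>det2 e g\<bar>) \<longrightarrow>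
    card G \<le> nat \<lceil>2 powr (3 * \<epsilon> * real r)\<rceil>"
proof -
  define \<eta> where "\<eta> = d - (2 * s + 2 * \<kappa> + 5 * \<epsilon>)"
  have "0 < \<eta>" using gap by (simp add: \<eta>_def)
  then have "\<forall>\<^sub>F r in sequentially. 4 * 17\<^sup>2 \<le> 2 powr (\<eta> * real r)" by real_asymp
  then have "\<forall>\<^sub>F r in sequentially. 4 * (17\<^sup>2 * 2 powr ((2 * s + 2 * \<kappa> + 3 * \<epsilon>) * real r)) \<le> 2 powr ((d - 2 * \<epsilon>) * real r)"
  proof eventually_elim
    case (elim r)
    then have "4 * 17\<^sup>2 * 2 powr ((2 * s + 2 * \<kappa> + 3 * \<epsilon>) * real r) \<le> 2 powr (\<eta> * real r) * 2 powr ((2 * s + 2 * \<kappa> + 3 * \<epsilon>) * real r)"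
      by (intro mult_right_mono) auto
    then show ?case by (simp add: powr_add[symmetric] \<eta>_def algebra_simps)
  qed
  moreover have "\<forall>\<^sub>F r in sequentially. 324 * 2 powr (2 * \<epsilon> * real r) < 2 powr (3 * \<epsilon> * real r)"
    using \<epsilon> by real_asymp
  ultimately show ?thesis
  proof (rule eventually_elim2, intro allI impI)
    fix r n G
    assume e1: "4 * (17\<^sup>2 * 2 powr ((2 * s + 2 * \<kappa> + 3 * \<epsilon>) * real r)) \<le> 2 powr ((d - 2 * \<epsilon>) * real r)"
      and e2: "324 * 2 powr (2 * \<epsilon> * real r) < 2 powr (3 * \<epsilon> * real r)"
      and G: "finite G" "G \<subseteq> heavy_directions U A s d \<epsilon> r n"
        "\<forall>e\<in>G. \<forall>g\<in>G. e \<noteq> g \<longrightarrow> 2 powr (- (\<kappa> * real r)) \<le> \<bar>det2 e g\<bar>"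
    define m where "m = nat \<lceil>2 powr (3 * \<epsilon> * real r)\<rceil>"
    define L where "L = 2 powr (max (real n) (d * real r) - 2 * \<epsilon> * real r)"
    define \<theta> where "\<theta> = 2 powr (- (\<kappa> * real r))"
    define c where "c = (2 powr (s * real r))\<^sup>2 * (17 / \<theta>)\<^sup>2"
    have one: "1 \<le> 2 powr (3 * \<epsilon> * real r)" using \<epsilon> by (simp add: ge_one_powr_ge_zero)
    have m: "2 powr (3 * \<epsilon> * real r) \<le> real m" "real m \<le> 2 * 2 powr (3 * \<epsilon> * real r)"
      unfolding m_def using one by linarith+
    show "card G \<le> nat \<lceil>2 powr (3 * \<epsilon> * real r)\<rceil>"
    proof (rule ccontr)
      assume "\<not> card G \<le> nat \<lceil>2 powr (3 * \<epsilon> * real r)\<rceil>"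
      then have "m \<le> card G" unfolding m_def by linarith
      \<comment> \<open>Exactly \<open>m\<close> directions are kept, because the overlap term grows
        with the square of their number.\<close>
      then obtain H where H: "H \<subseteq> G" "card H = m" "finite H" by (rule obtain_subset_with_card_n)
      have "\<forall>e\<in>H. \<exists>Y. norm e = 1 \<and> finite Y \<and> real (card Y) \<le> 2 powr (s * real r) \<and>
         L \<le> real (card (simple_grid U A r n \<inter> grid_strips r e Y))"
        using H(1) G(2) unfolding heavy_directions_def L_def by blast
      then obtain Y where Y: "\<And>e. e \<in> H \<Longrightarrow> norm e = 1 \<and> finite (Y e) \<and> real (card (Y e)) \<le> 2 powr (s * real r) \<and>
         L \<le> real (card (simple_grid U A r n \<inter> grid_strips r e (Y e)))"
        by metis
      define S where "S = (\<lambda>e. simple_grid U A r n \<inter> grid_strips r e (Y e))"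
      have "2 powr (- (\<kappa> * real r)) \<le> 2 powr 0" using \<kappa> by (intro powr_mono) auto
      then have \<theta>: "0 < \<theta>" "\<theta> \<le> 1" unfolding \<theta>_def by auto
      have int: "real (card (S e \<inter> S g)) \<le> c" if "e \<in> H" "g \<in> H" "e \<noteq> g" for e g
      proof -
        have "\<theta> \<le> \<bar>det2 e g\<bar>" unfolding \<theta>_def using G(3) H(1) that by blast
        then have "finite (grid_strips r e (Y e) \<inter> grid_strips r g (Y g))"
          "real (card (grid_strips r e (Y e) \<inter> grid_strips r g (Y g))) \<le> c"
          unfolding c_def using Y that \<theta> card_grid_strips_Int[of e g \<theta> "Y e" "Y g"] by blast+
        then show ?thesis using card_mono[of "grid_strips r e (Y e) \<inter> grid_strips r g (Y g)" "S e \<inter> S g"]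
          unfolding S_def by force
      qed
      have "real m * L \<le> real (card (\<Union>e\<in>H. S e)) + (real m)\<^sup>2 * c"
        unfolding H(2)[symmetric]
      proof (rule card_UN_ge_Bonferroni[OF H(3) _ _ int])
        show "finite (S e)" for e unfolding S_def using finite_simple_grid by blast
      qed (use Y in \<open>auto simp: S_def c_def\<close>)
      moreover have "real (card (\<Union>e\<in>H. S e)) \<le> 162 * 2 ^ n"
      proof -
        have "card (\<Union>e\<in>H. S e) \<le> card (simple_grid U A r n)"
          by (intro card_mono finite_simple_grid) (auto simp: S_def)
        then show ?thesis using card_simple_grid[of U A r n] by linarith
      qed
      \<comment> \<open>This uses the entry \<open>real n\<close> of the maximum in
        \<open>L\<close>; the next estimate uses the entry \<open>d * real r\<close>.\<close>
      moreover have "162 * 2 ^ n \<le> 162 * 2 powr (2 * \<epsilon> * real r) * L"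
        unfolding L_def by (simp add: powr_add[symmetric] powr_realpow[symmetric])
      moreover have "real m * c \<le> L / 2"
      proof -
        have "c = 17\<^sup>2 * 2 powr ((2 * s + 2 * \<kappa>) * real r)"
          unfolding c_def \<theta>_def by (simp add: powr_minus power2_eq_square powr_add[symmetric] algebra_simps inverse_eq_divide)
        then have "real m * c \<le> 2 * 2 powr (3 * \<epsilon> * real r) * (17\<^sup>2 * 2 powr ((2 * s + 2 * \<kappa>) * real r))"
          using m(2) by (intro mult_mono) auto
        also have "\<dots> = 2 * (17\<^sup>2 * 2 powr ((2 * s + 2 * \<kappa> + 3 * \<epsilon>) * real r))"
          by (simp add: powr_add[symmetric] algebra_simps)
        also have "\<dots> \<le> 2 powr ((d - 2 * \<epsilon>) * real r) / 2" using e1 by simp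
        also have "\<dots> \<le> L / 2" unfolding L_def by (simp add: algebra_simps)
        finally show ?thesis .
      qed
      then have "real m * (real m * c) \<le> real m * (L / 2)" by (intro mult_left_mono) auto
      ultimately have "real m * L \<le> 162 * 2 powr (2 * \<epsilon> * real r) * L + real m * (L / 2)"
        by (simp add: power2_eq_square mult.assoc)
      then have "(real m / 2) * L \<le> (162 * 2 powr (2 * \<epsilon> * real r)) * L" by (simp add: algebra_simps)
      moreover have "L > 0" by (simp add: L_def)
      ultimately have "real m / 2 \<le> 162 * 2 powr (2 * \<epsilon> * real r)" by (simp only: mult_le_cancel_right_pos)
      then show False using m(1) e2 by linarith
    qed
  qed
qed

text \<open>At each large scale and for each \<open>n\<close>, a maximal separated family of heavy
  directions, together with its negatives, is a net of radius 2 \<theta>. The number of balls grows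
  more slowly than \<theta>^(-t), so \<open>hausdorff_measure_limsup_null\<close> applies; by
  \<open>optimal_oracle_heavy_strips\<close> each direction in the set is heavy at infinitely many
  scales.\<close>

lemma hausdorff_measure_small_projections_null:
  fixes E :: "(real ^ 2) set"
  assumes U: "universal_prefix_machine U" and opt: "optimal_hausdorff_oracle U A E"
    and s: "ereal (2 * s) < hausdorff_dim E" and t: "0 < t"
  shows "hausdorff_measure t {e. norm e = 1 \<and>
     (\<exists>Y. (\<forall>\<^sub>F r in sequentially. finite (Y r) \<and> real (card (Y r)) \<le> 2 powr (s * real r)) \<and>
        (\<forall>x\<in>E. \<exists>\<^sub>F r in sequentially. \<exists>y\<in>Y r. \<bar>x \<bullet> e - y\<bar> \<le> 1 / 2 ^ r))} = 0"
    (is "hausdorff_measure t ?D = 0")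
proof -
  obtain d where d: "2 * s < d" "ereal d < hausdorff_dim E"
    using ereal_dense2[OF s] by auto
  \<comment> \<open>The terms 2 \<kappa> and 5 \<epsilon> use one half and at most one quarter of
    the gap d - 2 s. By \<epsilon> \<le> \<kappa> t / 6 the growth 2^(3 \<epsilon> r) of the number
    of balls is dominated by the decay 2^(-\<kappa> t r) of their cost.\<close>
  define \<kappa> where "\<kappa> = (d - 2 * s) / 4"
  define \<epsilon> where "\<epsilon> = min ((d - 2 * s) / 20) (\<kappa> * t / 6)"
  have \<kappa>: "0 < \<kappa>" using d by (simp add: \<kappa>_def)
  have \<epsilon>: "0 < \<epsilon>" using d \<kappa> t by (simp add: \<epsilon>_def)
  have "\<epsilon> \<le> (d - 2 * s) / 20" unfolding \<epsilon>_def by (rule min.cobounded1)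
  then have gap: "2 * s + 2 * \<kappa> + 5 * \<epsilon> < d" using d(1) unfolding \<kappa>_def by (simp add: field_simps)
  have "\<epsilon> \<le> \<kappa> * t / 6" unfolding \<epsilon>_def by (rule min.cobounded2)
  then have \<epsilon>t: "3 * \<epsilon> \<le> \<kappa> * t / 2" by simp
  let ?F = "heavy_directions U A s d \<epsilon>"
  let ?m = "\<lambda>r. nat \<lceil>2 powr (3 * \<epsilon> * real r)\<rceil>"
  define \<theta> where "\<theta> = (\<lambda>r::nat. 2 powr (- (\<kappa> * real r)))"
  obtain R where R: "\<And>r n G. R \<le> r \<Longrightarrow> finite G \<Longrightarrow> G \<subseteq> ?F r n \<Longrightarrow>
    \<forall>e\<in>G. \<forall>g\<in>G. e \<noteq> g \<longrightarrow> \<theta> r \<le> \<bar>det2 e g\<bar> \<Longrightarrow> card G \<le> ?m r"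
    using card_separated_heavy_directions[OF \<kappa> \<epsilon> gap, of U A]
    unfolding eventually_sequentially \<theta>_def by meson
  have "\<exists>G. finite G \<and> card G \<le> ?m r \<and>
     (\<forall>e\<in>?F r n. \<exists>g\<in>G. norm (g - e) \<le> 2 * \<theta> r \<or> norm (- g - e) \<le> 2 * \<theta> r)" if r: "R \<le> r" for r n
  proof -
    obtain G where G: "finite G" "G \<subseteq> ?F r n" "card G \<le> ?m r"
      "\<And>e. e \<in> ?F r n \<Longrightarrow> e \<in> G \<or> (\<exists>g\<in>G. \<not> \<theta> r \<le> \<bar>det2 g e\<bar>)"
    proof (rule finite_net_exists[where P = "\<lambda>e g. \<theta> r \<le> \<bar>det2 e g\<bar>" and F = "?F r n" and m = "?m r"])
      show "\<theta> r \<le> \<bar>det2 y x\<bar>" if "\<theta> r \<le> \<bar>det2 x y\<bar>" for x y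
      proof -
        have "det2 y x = - det2 x y" by (simp add: det2_def algebra_simps)
        then show ?thesis using that by simp
      qed
    qed (use R[OF r] in auto)
    have "\<exists>g\<in>G. norm (g - e) \<le> 2 * \<theta> r \<or> norm (- g - e) \<le> 2 * \<theta> r" if e: "e \<in> ?F r n" for e
      using G(4)[OF e]
    proof
      assume "e \<in> G"
      then show ?thesis by (intro bexI[of _ e]) (auto simp: \<theta>_def)
    next
      assume "\<exists>g\<in>G. \<not> \<theta> r \<le> \<bar>det2 g e\<bar>"
      then obtain g where g: "g \<in> G" "\<bar>det2 g e\<bar> < \<theta> r" by auto
      then have "norm g = 1" "norm e = 1" using G(2) e by (auto simp: heavy_directions_def)
      then show ?thesis using almost_parallel g by blast
    qed
    then show ?thesis using G by blast
  qed
  then obtain G where G: "\<And>r n. R \<le> r \<Longrightarrow> finite (G r n)" "\<And>r n. R \<le> r \<Longrightarrow> card (G r n) \<le> ?m r"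
    "\<And>r n e. R \<le> r \<Longrightarrow> e \<in> ?F r n \<Longrightarrow> \<exists>g\<in>G r n. norm (g - e) \<le> 2 * \<theta> r \<or> norm (- g - e) \<le> 2 * \<theta> r"
    by metis
  define Z where "Z = (\<lambda>r. if R \<le> r then \<Union>n\<le>4 * r. G r n \<union> uminus ` G r n else {})"
  show ?thesis
  proof (rule hausdorff_measure_limsup_null[where Z = Z and \<rho> = "\<lambda>r. 2 * \<theta> r"])
    show "finite (Z r)" for r unfolding Z_def using G(1) by auto
    show "0 \<le> 2 * \<theta> r" for r by (simp add: \<theta>_def)
    show "(\<lambda>r. 2 * \<theta> r) \<longlonglongrightarrow> 0" unfolding \<theta>_def using \<kappa> by real_asymp
    show "0 < t" by fact
  next
    have card: "real (card (Z r)) \<le> real (4 * r + 1) * (4 * 2 powr (3 * \<epsilon> * real r))" for r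
    proof (cases "R \<le> r")
      case True
      have "1 \<le> 2 powr (3 * \<epsilon> * real r)" using \<epsilon> by (simp add: ge_one_powr_ge_zero)
      then have m: "real (?m r) \<le> 2 * 2 powr (3 * \<epsilon> * real r)" by linarith
      have "real (card (G r n \<union> uminus ` G r n)) \<le> 4 * 2 powr (3 * \<epsilon> * real r)" for n
      proof -
        have "card (G r n \<union> uminus ` G r n) \<le> card (G r n) + card (uminus ` G r n)" by (rule card_Un_le)
        also have "\<dots> \<le> ?m r + ?m r"
          using G(1,2)[OF True, of n] card_image_le[of "G r n" uminus] by linarith
        finally show ?thesis using m by linarith
      qed
      then show ?thesis unfolding Z_def using True card_UN_le_mult[of "{..4 * r}" "\<lambda>n. G r n \<union> uminus ` G r n"]
        by simp
    qed (simp add: Z_def)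
    \<comment> \<open>Exponents in units of \<beta> r: the net contributes at most 2, the polynomial
      factor 1 and the balls -4, which leaves geometric decay with exponent -1.\<close>
    define \<beta> where "\<beta> = \<kappa> * t / 4"
    have \<beta>: "0 < \<beta>" using \<kappa> t by (simp add: \<beta>_def)
    have "\<forall>\<^sub>F r in sequentially. real (4 * r + 1) * 4 * 4 powr t \<le> 2 powr (\<beta> * real r)"
      using \<beta> by real_asymp
    then have "\<forall>\<^sub>F r in sequentially. norm (real (card (Z r)) * (2 * (2 * \<theta> r)) powr t) \<le> (2 powr (- \<beta>)) ^ r"
    proof eventually_elim
      case (elim r)
      have "3 * \<epsilon> * real r \<le> 2 * \<beta> * real r" using \<epsilon>t by (intro mult_right_mono) (auto simp: \<beta>_def)
      then have \<epsilon>r: "2 powr (3 * \<epsilon> * real r) \<le> 2 powr (2 * \<beta> * real r)" by simp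
      have \<theta>t: "(2 * (2 * \<theta> r)) powr t = 4 powr t * 2 powr (- (4 * \<beta> * real r))"
      proof -
        have "(2 * (2 * \<theta> r)) powr t = (4 * \<theta> r) powr t" by simp
        also have "\<dots> = 4 powr t * \<theta> r powr t" by (rule powr_mult)
        also have "\<theta> r powr t = 2 powr (- (4 * \<beta> * real r))" by (simp add: \<theta>_def powr_powr \<beta>_def mult_ac)
        finally show ?thesis .
      qed
      have "real (card (Z r)) * (2 * (2 * \<theta> r)) powr t
        \<le> real (4 * r + 1) * (4 * 2 powr (2 * \<beta> * real r)) * (4 powr t * 2 powr (- (4 * \<beta> * real r)))"
        unfolding \<theta>t using card[of r] \<epsilon>r by (intro mult_right_mono) (auto intro: order_trans mult_left_mono)
      also have "\<dots> = (real (4 * r + 1) * 4 * 4 powr t) * (2 powr (2 * \<beta> * real r) * 2 powr (- (4 * \<beta> * real r)))"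
        by (simp only: mult_ac)
      also have "\<dots> \<le> 2 powr (\<beta> * real r) * (2 powr (2 * \<beta> * real r) * 2 powr (- (4 * \<beta> * real r)))"
        by (intro mult_right_mono elim) auto
      also have "\<dots> = (2 powr (- \<beta>)) powr real r" by (simp add: powr_add[symmetric] powr_powr)
      also have "\<dots> = (2 powr (- \<beta>)) ^ r" by (simp add: powr_realpow)
      finally show ?case by (simp add: abs_mult)
    qed
    moreover have "summable (\<lambda>r. (2 powr (- \<beta>)) ^ r)"
      using \<beta> by (intro summable_geometric) (simp add: powr_less_one)
    ultimately show "summable (\<lambda>r. real (card (Z r)) * (2 * (2 * \<theta> r)) powr t)"
      by (rule summable_comparison_test_ev)
  next
    fix e assume "e \<in> ?D"
    then obtain Y where e: "norm e = 1"
      and Y: "\<forall>\<^sub>F r in sequentially. finite (Y r) \<and> real (card (Y r)) \<le> 2 powr (s * real r)"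
      "\<And>x. x \<in> E \<Longrightarrow> \<exists>\<^sub>F r in sequentially. \<exists>y\<in>Y r. \<bar>x \<bullet> e - y\<bar> \<le> 1 / 2 ^ r" by blast
    have "\<forall>\<^sub>F r in sequentially. (\<exists>n\<le>4 * r. 2 powr (max (real n) (d * real r) - 2 * \<epsilon> * real r) \<le>
       real (card (simple_grid U A r n \<inter> grid_strips r e (Y r)))) \<longrightarrow> (\<exists>z\<in>Z r. dist z e \<le> 2 * \<theta> r)"
      using Y(1) eventually_ge_at_top[of R]
    proof eventually_elim
      case (elim r)
      show ?case
      proof
        assume "\<exists>n\<le>4 * r. 2 powr (max (real n) (d * real r) - 2 * \<epsilon> * real r) \<le>
          real (card (simple_grid U A r n \<inter> grid_strips r e (Y r)))"
        then obtain n where n: "n \<le> 4 * r" "e \<in> ?F r n"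
          using e elim(1) unfolding heavy_directions_def by blast
        then obtain g where "g \<in> G r n" "norm (g - e) \<le> 2 * \<theta> r \<or> norm (- g - e) \<le> 2 * \<theta> r"
          using G(3)[OF elim(2)] by blast
        then show "\<exists>z\<in>Z r. dist z e \<le> 2 * \<theta> r"
          using n(1) elim(2) unfolding Z_def dist_norm by force
      qed
    qed
    with optimal_oracle_heavy_strips[OF U opt d(2) \<epsilon> e Y(2)]
    show "\<exists>\<^sub>F r in sequentially. \<exists>z\<in>Z r. dist z e \<le> 2 * \<theta> r"
      by (rule frequently_rev_mp)
  qed
qed

theorem theorem13:
  fixes U :: oracle_machine and E :: "(real ^ 2) set"
  assumes "universal_prefix_machine U"
    and "\<exists>A. optimal_hausdorff_oracle U A E"
  shows "hausdorff_dim {e \<in> sphere (0 :: real ^ 2) 1.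
           hausdorff_dim ((\<lambda>x. x \<bullet> e) ` E) < hausdorff_dim E / 2} = 0"
proof -
  let ?X = "{e \<in> sphere (0 :: real ^ 2) 1. hausdorff_dim ((\<lambda>x. x \<bullet> e) ` E) < hausdorff_dim E / 2}"
  obtain A where A: "optimal_hausdorff_oracle U A E" using assms(2) by blast
  define D where "D = (\<lambda>s. {e. norm e = 1 \<and>
     (\<exists>Y. (\<forall>\<^sub>F r in sequentially. finite (Y r) \<and> real (card (Y r)) \<le> 2 powr (s * real r)) \<and>
        (\<forall>x\<in>E. \<exists>\<^sub>F r in sequentially. \<exists>y\<in>Y r. \<bar>x \<bullet> e - y\<bar> \<le> 1 / 2 ^ r))} :: (real ^ 2) set)"
  \<comment> \<open>Restricting to rational thresholds, enumerated by \<open>from_nat\<close>, makes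
    the union countable.\<close>
  define D' where "D' = (\<lambda>i. let s = of_rat (from_nat i) in if ereal (2 * s) < hausdorff_dim E then D s else {})"
  have "?X \<subseteq> (\<Union>i. D' i)"
  proof
    fix e assume "e \<in> ?X"
    then have e: "norm e = 1" "hausdorff_dim ((\<lambda>x. x \<bullet> e) ` E) < hausdorff_dim E / 2" by auto
    then obtain s where s: "0 < s" "hausdorff_measure s ((\<lambda>x. x \<bullet> e) ` E) = 0" "ereal s < hausdorff_dim E / 2"
      unfolding hausdorff_dim_def[of "(\<lambda>x. x \<bullet> e) ` E"] Inf_less_iff by blast
    \<comment> \<open>The room between \<open>s\<close> and \<open>q\<close> lets
      \<open>hausdorff_null_dyadic_nets\<close> turn covers of the projection into nets.\<close>
    obtain q where q: "ereal s < ereal (of_rat q)" "ereal (of_rat q) < hausdorff_dim E / 2"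
      using ereal_dense3[OF s(3)] by blast
    obtain Y where Y: "\<forall>\<^sub>F r in sequentially. finite (Y r) \<and> real (card (Y r)) \<le> 2 powr (of_rat q * real r)"
      "\<And>x. x \<in> (\<lambda>x. x \<bullet> e) ` E \<Longrightarrow> \<exists>\<^sub>F r in sequentially. \<exists>y\<in>Y r. dist x y \<le> 1 / 2 ^ r"
      using hausdorff_null_dyadic_nets[OF s(2) s(1), of "of_rat q"] q(1) by auto
    have "e \<in> D (of_rat q)" unfolding D_def using e(1) Y by (auto simp: dist_real_def)
    moreover have "ereal (2 * of_rat q) < hausdorff_dim E"
      using q(2) by (cases "hausdorff_dim E") auto
    ultimately have "e \<in> D' (to_nat q)" by (simp add: D'_def)
    then show "e \<in> (\<Union>i. D' i)" by blast
  qed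
  moreover have "hausdorff_measure t (\<Union>i. D' i) = 0" if "0 < t" for t
  proof (rule hausdorff_measure_UN_null)
    fix i
    have "hausdorff_measure t ({} :: (real ^ 2) set) = 0"
      by (simp add: hausdorff_measure_eq_0_iff hausdorff_premeasure_empty)
    then show "hausdorff_measure t (D' i) = 0"
      using hausdorff_measure_small_projections_null[OF assms(1) A _ that]
      by (simp add: D'_def D_def Let_def)
  qed
  ultimately have null: "hausdorff_measure t ?X = 0" if "0 < t" for t
    using hausdorff_measure_mono[of ?X "\<Union>i. D' i" t] that by simp
  have "hausdorff_dim ?X \<le> ereal t" if "0 < t" for t
    using that null[OF that] by (rule hausdorff_dim_le)
  then have "hausdorff_dim ?X \<le> 0"
    by (rule ereal_le_epsilon2[of _ 0, unfolded add_0])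
  moreover have "0 \<le> hausdorff_dim ?X" by (rule hausdorff_dim_nonneg)
  ultimately show ?thesis by (rule antisym)
qed

end
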